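(* Let $\preceq$ be the prefix relation or the infix relation. If the universal-variant of the $\preceq$-matching problem (given $w\in\Sigma^*$ and an $\varepsilon$NFA $A$ with $m$ transitions, decide whether $\{u\mid u\preceq w\}\subseteq\mathcal{L}(A)$) can be solved in time $O((|w|m)^{1-\epsilon})$ for some $\epsilon>0$, then the Strong Exponential Time Hypothesis (SETH) fails.
   Context: An $\varepsilon$NFA is a tuple $A=(Q,\Sigma,q_0,q_f,\delta)$ with $\delta\subseteq Q\times(\Sigma\cup\{\varepsilon\})\times Q$, size $m=|\delta|$; $\mathcal{L}(A)$ is the set of strings labelling (ignoring $\varepsilon$) a path from $q_0$ to $q_f$. Infix: $u\preceq w$ iff $w=vuv'$ for some strings $v,v'$; prefix: $u\preceq w$ iff $w=uv$ for some string $v$. *)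

theory Defs
  imports Complex_Main "HOL-Library.Sublist"
begin

section \<open>Automata with epsilon-transitions\<close>

text \<open>The label \<open>None\<close> of a transition stands for the empty word.\<close>

record ('q, 'a) enfa =
  states :: "'q set"
  alphabet :: "'a set"
  start :: 'q
  final :: 'q
  trans :: "('q \<times> 'a option \<times> 'q) set"

definition enfa_wf :: "('q, 'a) enfa \<Rightarrow> bool" where
  "enfa_wf A \<longleftrightarrow> finite (states A) \<and> finite (alphabet A) \<and> start A \<in> states A \<and> final A \<in> states A \<and>
     trans A \<subseteq> states A \<times> insert None (Some ` alphabet A) \<times> states A"

inductive enfa_path :: "('q, 'a) enfa \<Rightarrow> 'q \<Rightarrow> 'a list \<Rightarrow> 'q \<Rightarrow> bool" for A where
  "enfa_path A q [] q"
| "(p, None, q) \<in> trans A \<Longrightarrow> enfa_path A q u r \<Longrightarrow> enfa_path A p u r"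
| "(p, Some a, q) \<in> trans A \<Longrightarrow> enfa_path A q u r \<Longrightarrow> enfa_path A p (a # u) r"

definition enfa_lang :: "('q, 'a) enfa \<Rightarrow> 'a list set" where
  "enfa_lang A = {u. enfa_path A (start A) u (final A)}"


section \<open>Word RAM\<close>

text \<open>
  A unit-cost random access machine with registers and an addressable memory, whose cells hold
  \<open>W\<close>-bit words. Control is structured; compared with jumps this changes running times
  by a constant factor only. Subtraction is truncated at 0, and division by zero gives 0.
\<close>

datatype binop = Add | Sub | Mul | Div | Mod | And | Or | Xor | Shl | Shr

fun binop_val :: "binop \<Rightarrow> nat \<Rightarrow> nat \<Rightarrow> nat" where
  "binop_val Add x y = x + y"
| "binop_val Sub x y = x - y"
| "binop_val Mul x y = x * y"
| "binop_val Div x y = x div y"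
| "binop_val Mod x y = x mod y"
| "binop_val And x y = Bit_Operations.and x y"
| "binop_val Or x y = Bit_Operations.or x y"
| "binop_val Xor x y = Bit_Operations.xor x y"
| "binop_val Shl x y = push_bit y x"
| "binop_val Shr x y = drop_bit y x"

datatype com =
    Skip
  | Const nat nat              \<comment> \<open>\<open>Const r n\<close>: register \<open>r\<close> := \<open>n\<close>\<close>
  | Op binop nat nat nat       \<comment> \<open>\<open>Op f r a b\<close>: register \<open>r\<close> := register \<open>a\<close> \<open>f\<close> register \<open>b\<close>\<close>
  | Load nat nat               \<comment> \<open>\<open>Load r a\<close>: register \<open>r\<close> := memory at the address in register \<open>a\<close>\<close>
  | Store nat nat              \<comment> \<open>\<open>Store a r\<close>: memory at the address in register \<open>a\<close> := register \<open>r\<close>\<close>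
  | Seq com com
  | If nat com com             \<comment> \<open>tests whether a register is nonzero\<close>
  | While nat com

record state =
  reg :: "nat \<Rightarrow> nat"
  mem :: "nat \<Rightarrow> nat"

text \<open>
  \<open>exec W c s t s'\<close>: on word size \<open>W\<close>, the program \<open>c\<close> started in \<open>s\<close> halts after \<open>t\<close> steps in \<open>s'\<close>.
  There is no wrap-around: an operation whose result does not fit into a word has no successor
  state, so a halting run uses only values and addresses below \<open>2 ^ W\<close>.
\<close>

inductive exec :: "nat \<Rightarrow> com \<Rightarrow> state \<Rightarrow> nat \<Rightarrow> state \<Rightarrow> bool" for W where
  Skip: "exec W Skip s 1 s"
| Const: "n < 2 ^ W \<Longrightarrow> exec W (Const r n) s 1 (s\<lparr>reg := (reg s)(r := n)\<rparr>)"
| Op: "v = binop_val f (reg s a) (reg s b) \<Longrightarrow> v < 2 ^ W \<Longrightarrow>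
    exec W (Op f r a b) s 1 (s\<lparr>reg := (reg s)(r := v)\<rparr>)"
| Load: "exec W (Load r a) s 1 (s\<lparr>reg := (reg s)(r := mem s (reg s a))\<rparr>)"
| Store: "exec W (Store a r) s 1 (s\<lparr>mem := (mem s)(reg s a := reg s r)\<rparr>)"
| Seq: "exec W c1 s t1 s1 \<Longrightarrow> exec W c2 s1 t2 s2 \<Longrightarrow> exec W (Seq c1 c2) s (t1 + t2) s2"
| IfTrue: "reg s r \<noteq> 0 \<Longrightarrow> exec W c1 s t s' \<Longrightarrow> exec W (If r c1 c2) s (Suc t) s'"
| IfFalse: "reg s r = 0 \<Longrightarrow> exec W c2 s t s' \<Longrightarrow> exec W (If r c1 c2) s (Suc t) s'"
| WhileFalse: "reg s r = 0 \<Longrightarrow> exec W (While r c) s 1 s"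
| WhileTrue: "reg s r \<noteq> 0 \<Longrightarrow> exec W c s t1 s1 \<Longrightarrow> exec W (While r c) s1 t2 s2 \<Longrightarrow>
    exec W (While r c) s (Suc (t1 + t2)) s2"

definition init_state :: "nat list \<Rightarrow> state" where
  "init_state xs = \<lparr>reg = (\<lambda>_. 0)(0 := length xs),
                    mem = (\<lambda>i. if i < length xs then xs ! i else 0)\<rparr>"

text \<open>
  \<open>solvable_in_time enc yes T\<close>: a single program decides \<open>yes\<close> in time \<open>O(T)\<close>. The relation
  \<open>enc\<close> says which word sequences present an instance; the program has to succeed on each of them.
  Words have the usual logarithmic size: \<open>W\<close> is \<open>O(log)\<close> of input length, input entries and time
  bound (the latter matters for exponential-time algorithms, which need long addresses).
  Acceptance is a nonzero value in register 0.
\<close>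

definition solvable_in_time ::
    "('i \<Rightarrow> nat list \<Rightarrow> bool) \<Rightarrow> ('i \<Rightarrow> bool) \<Rightarrow> ('i \<Rightarrow> real) \<Rightarrow> bool" where
  "solvable_in_time enc yes T \<longleftrightarrow>
     (\<exists>P (c::real). \<forall>i xs. enc i xs \<longrightarrow>
        (\<exists>W t s'. real W \<le> c * log 2 (2 + real (length xs) + real (sum_list xs) + T i) \<and>
           (\<forall>x\<in>set (length xs # xs). x < 2 ^ W) \<and>
           exec W P (init_state xs) t s' \<and> real t \<le> c * T i \<and>
           (reg s' 0 \<noteq> 0 \<longleftrightarrow> yes i)))"


section \<open>The universal variant of the matching problem\<close>

text \<open>
  Instances are presented to the machine with states and letters numbered from 0. The label of a
  transition is coded by 0 for the empty word and by \<open>Suc a\<close> for the letter \<open>a\<close>. The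
  transitions may be listed in any order.
\<close>

fun code_trans :: "nat \<times> nat option \<times> nat \<Rightarrow> nat list" where
  "code_trans (p, l, q) = [p, (case l of None \<Rightarrow> 0 | Some a \<Rightarrow> Suc a), q]"

definition matching_enc :: "nat list \<times> (nat, nat) enfa \<Rightarrow> nat list \<Rightarrow> bool" where
  "matching_enc = (\<lambda>(w, A) xs. enfa_wf A \<and> w \<in> lists (alphabet A) \<and>
     (\<exists>n \<sigma> ts. states A = {..<n} \<and> alphabet A = {..<\<sigma>} \<and> distinct ts \<and> set ts = trans A \<and>
        xs = [n, \<sigma>, start A, final A, length w, length ts] @ w @ concat (map code_trans ts)))"

definition universal_matching ::
    "(nat list \<Rightarrow> nat list \<Rightarrow> bool) \<Rightarrow> nat list \<times> (nat, nat) enfa \<Rightarrow> bool" where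
  "universal_matching R = (\<lambda>(w, A). {u. R u w} \<subseteq> enfa_lang A)"

text \<open>
  The summand \<open>1 + |w| + m\<close> pays for reading the input. Without it the bound would be
  unattainable for trivial reasons: it vanishes for \<open>|w| = 0\<close> or \<open>m = 0\<close>, and for fixed \<open>m\<close> it is
  sublinear in \<open>|w|\<close>.
\<close>

definition matching_time :: "real \<Rightarrow> nat list \<times> (nat, nat) enfa \<Rightarrow> real" where
  "matching_time \<epsilon> = (\<lambda>(w, A).
     (1 + real (length w) + real (card (trans A))) +
     (real (length w) * real (card (trans A))) powr (1 - \<epsilon>))"


section \<open>The Strong Exponential Time Hypothesis\<close>

text \<open>
  A formula \<open>(n, F)\<close> has the variables \<open>0, \<dots>, n - 1\<close>; \<open>F\<close> is a list of clauses and a clause is a list of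
  literals \<open>(sign, variable)\<close>, where the sign \<open>True\<close> means a positive literal.
\<close>

type_synonym cnf = "nat \<times> (bool \<times> nat) list list"

definition ksat_wf :: "nat \<Rightarrow> cnf \<Rightarrow> bool" where
  "ksat_wf k = (\<lambda>(n, F). \<forall>C\<in>set F. length C \<le> k \<and> (\<forall>(b, v)\<in>set C. v < n))"

definition satisfiable :: "cnf \<Rightarrow> bool" where
  "satisfiable = (\<lambda>(n, F). \<exists>\<alpha> :: nat \<Rightarrow> bool. \<forall>C\<in>set F. \<exists>(b, v)\<in>set C. \<alpha> v = b)"

definition code_lit :: "bool \<times> nat \<Rightarrow> nat" where
  "code_lit = (\<lambda>(b, v). 2 * v + of_bool b)"

definition code_cnf :: "cnf \<Rightarrow> nat list" where
  "code_cnf = (\<lambda>(n, F). [n, length F] @ concat (map (\<lambda>C. length C # map code_lit C) F))"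

definition ksat_enc :: "nat \<Rightarrow> cnf \<Rightarrow> nat list \<Rightarrow> bool" where
  "ksat_enc k \<phi> xs \<longleftrightarrow> ksat_wf k \<phi> \<and> xs = code_cnf \<phi>"

text \<open>
  For every \<open>\<epsilon> > 0\<close> there is \<open>k\<close> such that k-SAT on \<open>n\<close> variables has no algorithm running in time
  \<open>2\<^sup>(\<^sup>1\<^sup>-\<^sup>\<epsilon>\<^sup>)\<^sup>n\<close> up to a factor polynomial in the length of the formula.
\<close>

definition SETH :: bool where
  "SETH \<longleftrightarrow> (\<forall>\<epsilon>>0. \<exists>k. \<forall>d::nat.
     \<not> solvable_in_time (ksat_enc k) satisfiable
         (\<lambda>\<phi>. 2 powr ((1 - \<epsilon>) * real (fst \<phi>)) * real (length (code_cnf \<phi>)) ^ d))"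

end

theory Submission
  imports Defs
begin

text \<open>
  Split the variables into two halves of size \<open>h\<close>. The word lists, for every assignment \<open>x\<close> of the first
  half, which clauses \<open>x\<close> satisfies; the automaton guesses an assignment \<open>y\<close> of the second half and
  checks that one of the listed rows satisfies all clauses that \<open>y\<close> leaves open. Hence both have size
  \<open>2\<^sup>h\<close> up to factors linear in the formula, and the word is accepted iff the formula is satisfiable.
  A start and an end marker occur together in no proper infix of the word, so the automaton can accept all
  proper infixes outright; the universal problem then asks about the word itself. A time bound
  \<open>(|w| m)\<^sup>1\<^sup>-\<^sup>\<epsilon>\<close> becomes \<open>2\<^sup>(\<^sup>1\<^sup>-\<^sup>\<epsilon>\<^sup>)\<^sup>n\<close> up to polynomial factors.

  The reduction must itself run on the word RAM. Its program appends the instance to the formula in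
  memory, moves it down to address 0 and clears the registers, so that the given program starts in exactly
  its initial state.
\<close>

section \<open>Weakest preconditions\<close>

text \<open>The postcondition receives the step count together with the final state, so termination,
  result and running time of a program are proved in one pass.\<close>

definition wp :: "nat \<Rightarrow> com \<Rightarrow> (nat \<Rightarrow> state \<Rightarrow> bool) \<Rightarrow> state \<Rightarrow> bool" where
  "wp W c Q s \<longleftrightarrow> (\<exists>t s'. exec W c s t s' \<and> Q t s')"

inductive_cases exec_SkipE: "exec W Skip s t s'"
inductive_cases exec_ConstE: "exec W (Const r n) s t s'"
inductive_cases exec_OpE: "exec W (Op f r a b) s t s'"
inductive_cases exec_LoadE: "exec W (Load r a) s t s'"
inductive_cases exec_StoreE: "exec W (Store r a) s t s'"
inductive_cases exec_SeqE: "exec W (Seq c d) s t s'"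
inductive_cases exec_IfE: "exec W (If r c d) s t s'"

lemma wp_Skip: "wp W Skip Q s \<longleftrightarrow> Q 1 s"
  unfolding wp_def by (auto elim!: exec_SkipE intro: exec.intros[unfolded One_nat_def])

lemma wp_Const: "wp W (Const r n) Q s \<longleftrightarrow> n < 2 ^ W \<and> Q 1 (s\<lparr>reg := (reg s)(r := n)\<rparr>)"
  unfolding wp_def by (auto elim!: exec_ConstE intro: exec.intros[unfolded One_nat_def])

lemma wp_Op: "wp W (Op f r a b) Q s \<longleftrightarrow> binop_val f (reg s a) (reg s b) < 2 ^ W \<and>
    Q 1 (s\<lparr>reg := (reg s)(r := binop_val f (reg s a) (reg s b))\<rparr>)"
  unfolding wp_def by (auto elim!: exec_OpE intro: exec.intros[unfolded One_nat_def])

lemma wp_Load: "wp W (Load r a) Q s \<longleftrightarrow> Q 1 (s\<lparr>reg := (reg s)(r := mem s (reg s a))\<rparr>)"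
  unfolding wp_def by (auto elim!: exec_LoadE intro: exec.intros[unfolded One_nat_def])

lemma wp_Store: "wp W (Store a r) Q s \<longleftrightarrow> Q 1 (s\<lparr>mem := (mem s)(reg s a := reg s r)\<rparr>)"
  unfolding wp_def by (auto elim!: exec_StoreE intro: exec.intros[unfolded One_nat_def])

lemma wp_Seq: "wp W (Seq c d) Q s \<longleftrightarrow> wp W c (\<lambda>t. wp W d (\<lambda>u. Q (t + u))) s"
  unfolding wp_def by (blast elim: exec_SeqE intro: exec.intros)

lemma wp_If: "wp W (If r c d) Q s \<longleftrightarrow>
    (if reg s r \<noteq> 0 then wp W c (\<lambda>t. Q (Suc t)) s else wp W d (\<lambda>t. Q (Suc t)) s)"
  unfolding wp_def by (auto elim!: exec_IfE intro: exec.intros)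

lemma wp_While_False: "reg s r = 0 \<Longrightarrow> Q 1 s \<Longrightarrow> wp W (While r c) Q s"
  unfolding wp_def by (blast intro: exec.intros)

lemma wp_While_True:
  "reg s r \<noteq> 0 \<Longrightarrow> wp W c (\<lambda>t. wp W (While r c) (\<lambda>u. Q (Suc (t + u)))) s \<Longrightarrow> wp W (While r c) Q s"
  unfolding wp_def by (blast intro: exec.intros)

lemmas wp_simps = wp_Skip wp_Const wp_Op wp_Load wp_Store wp_Seq wp_If

text \<open>Operations never wrap around, so a run that fits into \<open>W\<close> bits is unchanged
  on longer words. This lets the reduction and the given program run on a common word size.\<close>

lemma exec_word_mono:
  assumes "exec W c s t s'" "W \<le> W'"
  shows "exec W' c s t s'"
proof -
  have "n < 2 ^ W'" if "n < 2 ^ W" for n :: nat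
    using that power_increasing[OF assms(2), of "2::nat"] by linarith
  with assms(1) show ?thesis
    by (induction rule: exec.induct) (simp_all add: exec.intros[unfolded One_nat_def])
qed

fun seqs :: "com list \<Rightarrow> com" where
  "seqs [] = Skip"
| "seqs [c] = c"
| "seqs (c # d # cs) = Seq c (seqs (d # cs))"

section \<open>Evaluating clauses on the word RAM\<close>

definition memory :: "nat list \<Rightarrow> nat \<Rightarrow> nat" where
  "memory ys = (\<lambda>i. if i < length ys then ys ! i else 0)"

lemma memory_snoc: "(memory ys)(length ys := v) = memory (ys @ [v])"
  by (auto simp: memory_def fun_eq_iff nth_append)

lemma memory_nth_length: "memory (ys @ v # zs) (length ys) = v"
  by (simp add: memory_def)

text \<open>
  Register conventions of the reduction: 0 formula length, 1 the constant 1, 2 output address, 3 number of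
  clauses, 4 \<open>2\<^sup>h\<close>, 5 \<open>h\<close>, 6 counter for assignments, 7 and 8 bit masks of the variables set to true and to
  false, 9 current state, 10 read address, 11 counter for clauses, 12 counter for literals, 13 truth value
  of the clause, 17 first variable of the current half, 18 number of clauses plus 1, 19 \<open>2\<^sup>h - 1\<close>,
  21 successor of the current state; 14, 15 and 20 are scratch.
\<close>

datatype src = Imm nat | Reg nat

fun emits :: "src list \<Rightarrow> com" where
  "emits [] = Skip"
| "emits (Imm k # es) = Seq (Const 20 k) (Seq (Store 2 20) (Seq (Op Add 2 2 1) (emits es)))"
| "emits (Reg r # es) = Seq (Store 2 r) (Seq (Op Add 2 2 1) (emits es))"

fun src_val :: "state \<Rightarrow> src \<Rightarrow> nat" where
  "src_val s (Imm k) = k"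
| "src_val s (Reg r) = reg s r"

text \<open>Registers 2 and 20 change while cells are emitted. Constants below 16 fit into a word
  once \<open>16 \<le> 2 ^ W\<close>.\<close>

fun src_ok :: "src \<Rightarrow> bool" where
  "src_ok (Imm k) \<longleftrightarrow> k < 16"
| "src_ok (Reg r) \<longleftrightarrow> r \<noteq> 2 \<and> r \<noteq> 20"

lemma src_val_cong:
  "src_ok e \<Longrightarrow> (\<And>r. r \<noteq> 2 \<Longrightarrow> r \<noteq> 20 \<Longrightarrow> reg s' r = reg s r) \<Longrightarrow> src_val s' e = src_val s e"
  by (cases e) auto

lemma wp_emits:
  assumes "mem s = memory ys" "reg s 2 = length ys" "reg s 1 = 1"
    and "length ys + length es < 2 ^ W" "16 \<le> (2::nat) ^ W" "\<forall>e\<in>set es. src_ok e"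
    and "\<And>t s'. t \<le> 3 * length es + 1 \<Longrightarrow> mem s' = memory (ys @ map (src_val s) es) \<Longrightarrow>
      reg s' 2 = length ys + length es \<Longrightarrow> (\<And>r. r \<noteq> 2 \<Longrightarrow> r \<noteq> 20 \<Longrightarrow> reg s' r = reg s r) \<Longrightarrow> Q t s'"
  shows "wp W (emits es) Q s"
  using assms
proof (induction es arbitrary: s ys Q)
  case Nil
  then show ?case by (simp add: wp_simps)
next
  case (Cons e es)
  have same: "map (src_val (s\<lparr>mem := m, reg := (reg s)(20 := k, 2 := l)\<rparr>)) es = map (src_val s) es"
    "map (src_val (s\<lparr>mem := m, reg := (reg s)(2 := l)\<rparr>)) es = map (src_val s) es" for m k l
    using Cons.prems(6) by (auto intro!: src_val_cong)
  show ?case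
  proof (cases e)
    case (Imm k)
    show ?thesis unfolding Imm emits.simps
      using Cons.prems(1-6) Imm
      apply (simp add: wp_simps memory_snoc)
      apply (rule Cons.IH[where ys = "ys @ [k]"])
            apply (simp_all add: same del: fun_upd_apply)
        apply simp_all
      apply (rule Cons.prems(7))
      by (simp_all add: Imm)
  next
    case (Reg r)
    show ?thesis unfolding Reg emits.simps
      using Cons.prems(1-6) Reg
      apply (simp add: wp_simps memory_snoc)
      apply (rule Cons.IH[where ys = "ys @ [reg s r]"])
            apply (simp_all add: same del: fun_upd_apply)
        apply simp_all
      apply (rule Cons.prems(7))
      by (simp_all add: Reg)
  qed
qed

text \<open>The lowest bit of a literal code is the sign, the remaining bits are the variable. The
  sign selects the mask in register 7 or 8, and shifting that mask right by the variable brings the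
  relevant bit to position 0.\<close>

definition literal_step :: com where
  "literal_step = seqs [
     Op Sub 12 12 1, Load 14 10, Op Add 10 10 1, Op And 15 14 1, Op Shr 14 14 1,
     If 15 (Op Shr 14 7 14) (Op Shr 14 8 14), Op And 14 14 1, Op Or 13 13 14]"

definition literal_loop :: com where
  "literal_loop = While 12 literal_step"

lemma code_lit_bits:
  "code_lit (b, v) mod 2 = of_bool b" "drop_bit (Suc 0) (code_lit (b, v)) = v"
  by (auto simp: code_lit_def drop_bit_Suc)

lemma drop_bit_mod_2: "drop_bit v z mod 2 = of_bool (bit (z::nat) v)"
  by (simp add: bit_iff_odd_drop_bit mod_2_eq_odd)

text \<open>Positive literals are looked up in \<open>p\<close>, negative ones in \<open>q\<close>.
  With two masks, a variable outside the current half can have bit 0 in both, so that neither of its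
  literals counts as true.\<close>

definition clause_true :: "nat \<Rightarrow> nat \<Rightarrow> (bool \<times> nat) list \<Rightarrow> bool" where
  "clause_true p q C \<longleftrightarrow> (\<exists>(b, v)\<in>set C. bit (if b then p else q) v)"

lemma clause_true_simps:
  "\<not> clause_true p q []"
  "clause_true p q ((True, v) # C) \<longleftrightarrow> bit p v \<or> clause_true p q C"
  "clause_true p q ((False, v) # C) \<longleftrightarrow> bit q v \<or> clause_true p q C"
  by (simp_all add: clause_true_def)

lemma wp_literal_loop:
  assumes "mem s = memory (pre @ map code_lit C @ post)" "reg s 10 = length pre"
    and "reg s 12 = length C" "reg s 1 = 1" "reg s 13 = of_bool a"
    and "reg s 7 = p" "reg s 8 = q" "p < 2 ^ W" "q < 2 ^ W" "\<forall>l\<in>set C. code_lit l < 2 ^ W"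
    and "length pre + length C < 2 ^ W" "16 \<le> (2::nat) ^ W"
    and "\<And>t s'. t \<le> 10 * length C + 1 \<Longrightarrow> mem s' = mem s \<Longrightarrow> reg s' 10 = length pre + length C \<Longrightarrow>
      reg s' 13 = of_bool (a \<or> clause_true p q C) \<Longrightarrow>
      (\<And>r. r \<notin> {10, 12, 13, 14, 15} \<Longrightarrow> reg s' r = reg s r) \<Longrightarrow> Q t s'"
  shows "wp W literal_loop Q s"
  using assms
proof (induction C arbitrary: s pre a Q)
  case Nil
  show ?case unfolding literal_loop_def
    by (rule wp_While_False) (use Nil.prems in \<open>auto simp: clause_true_simps\<close>)
next
  case (Cons l C)
  obtain b v where l: "l = (b, v)" by (cases l)
  have "v \<le> code_lit (b, v)" by (simp add: code_lit_def)
  moreover have "code_lit (b, v) < 2 ^ W" using Cons.prems(10) l by simp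
  ultimately have v: "v < 2 ^ W" by linarith
  have db: "drop_bit v z < 2 ^ W" if "z < 2 ^ W" for z :: nat
    using that by (metis drop_bit_eq_div div_le_dividend le_less_trans)
  have or: "or (of_bool x) (of_bool y) = (of_bool (x \<or> y) :: nat)" for x y by auto
  have small: "of_bool x < (2::nat) ^ W" for x using Cons.prems(12) by (cases x) auto
  show ?case
  proof (rule wp_While_True[where c = literal_step and r = 12, folded literal_loop_def])
    show "reg s 12 \<noteq> 0" using Cons.prems(3) by simp
    show "wp W literal_step (\<lambda>t. wp W literal_loop (\<lambda>u. Q (Suc (t + u)))) s"
    proof (cases b)
      case True
      show ?thesis
        unfolding literal_step_def seqs.simps
        using Cons.prems(1-12) True
        apply (simp add: wp_simps l memory_nth_length code_lit_bits drop_bit_mod_2 or small v db del: of_bool_or_iff split del: split_of_bool)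
        apply (rule Cons.IH[where pre = "pre @ [code_lit l]" and a = "a \<or> bit p v"])
        apply (simp_all add: l or drop_bit_mod_2 small del: of_bool_or_iff split del: split_of_bool)
        apply (rule Cons.prems(13)) by (simp_all add: l clause_true_simps disj_assoc)
    next
      case False
      show ?thesis
        unfolding literal_step_def seqs.simps
        using Cons.prems(1-12) False
        apply (simp add: wp_simps l memory_nth_length code_lit_bits drop_bit_mod_2 or small v db del: of_bool_or_iff split del: split_of_bool)
        apply (rule Cons.IH[where pre = "pre @ [code_lit l]" and a = "a \<or> bit q v"])
        apply (simp_all add: l or drop_bit_mod_2 small del: of_bool_or_iff split del: split_of_bool)
        apply (rule Cons.prems(13)) by (simp_all add: l clause_true_simps disj_assoc)
    qed
  qed
qed

section \<open>Emitting one row of cells per clause\<close>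

fun row_val :: "nat \<Rightarrow> nat \<Rightarrow> src \<Rightarrow> nat" where
  "row_val q a (Imm k) = k"
| "row_val q a (Reg r) = (if r = 9 then q else if r = 13 then a else Suc q)"

fun row_ok :: "src \<Rightarrow> bool" where
  "row_ok (Imm k) \<longleftrightarrow> k < 16"
| "row_ok (Reg r) \<longleftrightarrow> r \<in> {9, 13, 21}"

lemma row_ok_imp_src_ok: "row_ok e \<Longrightarrow> src_ok e"
  by (cases e) auto

lemma src_val_eq_row_val:
  "row_ok e \<Longrightarrow> reg s 9 = q \<Longrightarrow> reg s 13 = a \<Longrightarrow> reg s 21 = Suc q \<Longrightarrow> src_val s e = row_val q a e"
  by (cases e) auto

text \<open>Register 13 contributes 1 plus the truth value of the clause. This is both a letter of
  the word and the code of a label \<open>Some (of_bool _)\<close>, so one loop serves the word and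
  the automaton.\<close>

fun rows :: "src list \<Rightarrow> nat \<Rightarrow> nat \<Rightarrow> nat \<Rightarrow> (bool \<times> nat) list list \<Rightarrow> nat list" where
  "rows es p q b [] = []"
| "rows es p q b (C # F) =
    map (row_val b (Suc (of_bool (clause_true p q C)))) es @ rows es p q (Suc b) F"

lemma length_rows: "length (rows es p q b F) = length F * length es"
  by (induction F arbitrary: b) auto

definition code_clause :: "(bool \<times> nat) list \<Rightarrow> nat list" where
  "code_clause C = length C # map code_lit C"

text \<open>\<open>Op Or\<close> of a register with itself acts as a copy: the successor state in
  register 21 becomes the current state.\<close>

definition clause_step :: "src list \<Rightarrow> com" where
  "clause_step es = seqs [
     Op Sub 11 11 1, Load 12 10, Op Add 10 10 1, Const 13 0, literal_loop, Op Add 13 13 1,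
     Op Add 21 9 1, emits es, Op Or 9 21 21]"

definition clause_loop :: "src list \<Rightarrow> com" where
  "clause_loop es = While 11 (clause_step es)"

text \<open>The output grows behind the formula and is absorbed by \<open>post\<close>, so the
  clauses stay readable. The length cell of each clause pays for its constant overhead and its
  emitted row, which makes the time linear in the code length.\<close>

lemma wp_clause_loop:
  assumes "mem s = memory ys" "reg s 2 = length ys" "ys = pre @ concat (map code_clause F) @ post"
    and "reg s 10 = length pre" "reg s 11 = length F" "reg s 1 = 1"
    and "reg s 7 = p" "reg s 8 = q" "p < 2 ^ W" "q < 2 ^ W" "\<forall>C\<in>set F. \<forall>l\<in>set C. code_lit l < 2 ^ W"
    and "length ys + length F * length es < 2 ^ W" "16 \<le> (2::nat) ^ W"
    and "reg s 9 = b" "b + length F < 2 ^ W" "\<forall>e\<in>set es. row_ok e"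
    and "\<And>t s'. t \<le> (10 + 3 * length es) * length (concat (map code_clause F)) + 1 \<Longrightarrow>
      mem s' = memory (ys @ rows es p q b F) \<Longrightarrow> reg s' 2 = length ys + length F * length es \<Longrightarrow>
      reg s' 9 = b + length F \<Longrightarrow>
      (\<And>r. r \<notin> {2, 9, 10, 11, 12, 13, 14, 15, 20, 21} \<Longrightarrow> reg s' r = reg s r) \<Longrightarrow> Q t s'"
  shows "wp W (clause_loop es) Q s"
  using assms
proof (induction F arbitrary: s ys pre post b Q)
  case Nil
  show ?case unfolding clause_loop_def
    by (rule wp_While_False) (use Nil.prems in auto)
next
  case (Cons C F)
  let ?a = "Suc (of_bool (clause_true p q C))"
  let ?ys = "ys @ map (row_val b ?a) es"
  have small: "of_bool x < (2::nat) ^ W" "Suc (of_bool x) < (2::nat) ^ W" for x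
    using Cons.prems(13) by (cases x; simp)+
  have ok: "\<forall>e\<in>set es. src_ok e" using Cons.prems(16) row_ok_imp_src_ok by blast
  have ys: "ys = pre @ length C # map code_lit C @ concat (map code_clause F) @ post"
    using Cons.prems(3) by (simp add: code_clause_def[of C])
  have len: "Suc (length pre + length C) \<le> length ys"
    using ys by simp
  have F: "length F < 2 ^ W" using Cons.prems(15) by simp
  have sv: "map (src_val u) es = map (row_val (reg u 9) (reg u 13)) es" if "reg u 21 = Suc (reg u 9)" for u
    using Cons.prems(16) that src_val_eq_row_val by auto
  show ?case
  proof (rule wp_While_True[where c = "clause_step es" and r = 11, folded clause_loop_def])
    show "reg s 11 \<noteq> 0" using Cons.prems(5) by simp
    show "wp W (clause_step es) (\<lambda>t. wp W (clause_loop es) (\<lambda>u. Q (Suc (t + u)))) s"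
      unfolding clause_step_def seqs.simps
      using Cons.prems(1,2,4-10,12,13) len F
      apply (simp add: wp_simps split del: split_of_bool)
      apply (rule wp_literal_loop[where pre = "pre @ [length C]" and C = C and a = False
            and post = "concat (map code_clause F) @ post" and p = p and q = q])
      subgoal by (simp add: ys)
      subgoal by simp
      subgoal by (simp add: ys memory_nth_length)
      subgoal by simp
      subgoal by simp
      subgoal by simp
      subgoal by simp
      subgoal by simp
      subgoal by simp
      subgoal using Cons.prems(11) by simp
      subgoal by simp
      subgoal by simp
      subgoal for t s'
        using Cons.prems(14,15)
        apply (simp add: wp_simps small split del: split_of_bool)
        apply (rule wp_emits[where ys = ys])
              apply simp_all
        subgoal using ok by simp
        subgoal for t2 s2
          apply (simp add: wp_simps sv split del: split_of_bool)
          apply (rule Cons.IH[where ys = "?ys" and pre = "pre @ code_clause C"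
                and post = "post @ map (row_val b ?a) es" and b = "Suc b"])
          using Cons.prems(11,16)
                          apply (simp_all add: ys code_clause_def[of C])
          subgoal
            apply (rule Cons.prems(17))
                apply (simp_all add: code_clause_def[of C] ys)
            by (simp add: algebra_simps)
          done
        done
      done
  qed
qed

section \<open>Looping over the assignments of one half\<close>

definition block :: "src list \<Rightarrow> src list \<Rightarrow> src list \<Rightarrow> nat \<Rightarrow> nat \<Rightarrow> (bool \<times> nat) list list \<Rightarrow> nat \<Rightarrow> nat list" where
  "block pre es post h sh F x = (let b = x * (length F + 1) + 4 in
     map (row_val b 0) pre @
     rows es (push_bit sh x) (push_bit sh (xor x (2 ^ h - 1))) b F @
     map (row_val (b + length F) 0) post)"

lemma length_block: "length (block pre es post h sh F x) = length pre + length F * length es + length post"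
  by (simp add: block_def Let_def length_rows)

text \<open>The counter is decremented before it is used as an assignment, so blocks appear in
  decreasing order, as in \<open>rev [0..<n]\<close>. Xor with \<open>2 ^ h - 1\<close> gives the
  mask of false variables, and reading restarts at cell 2, behind the two header cells of the
  formula.\<close>

definition outer_step :: "src list \<Rightarrow> src list \<Rightarrow> src list \<Rightarrow> com" where
  "outer_step pre es post = seqs [
     Op Sub 6 6 1, Op Shl 7 6 17, Op Xor 8 6 19, Op Shl 8 8 17, Op Mul 9 6 18, Const 20 4, Op Add 9 9 20,
     emits pre, Const 10 2, Op Or 11 3 3, clause_loop es, emits post]"

definition outer_loop :: "src list \<Rightarrow> src list \<Rightarrow> src list \<Rightarrow> com" where
  "outer_loop pre es post = While 6 (outer_step pre es post)"

fun edge_ok :: "src \<Rightarrow> bool" where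
  "edge_ok (Imm k) \<longleftrightarrow> k < 16"
| "edge_ok (Reg r) \<longleftrightarrow> r = 9"

lemma xor_mask_less:
  assumes "x < 2 ^ h" shows "xor x (2 ^ h - 1) < (2::nat) ^ h"
proof -
  have "take_bit h (xor x (mask h)) = xor x (mask h)"
    using assms by (simp add: take_bit_xor take_bit_nat_eq_self)
  then show ?thesis by (metis mask_eq_exp_minus_1 take_bit_nat_less_exp)
qed

text \<open>Masks of the second half are shifted by \<open>h\<close> and reach up to
  \<open>2 * h\<close> bits, hence the demand \<open>2 * h \<le> W\<close>.\<close>

lemma push_bit_less:
  assumes "x < 2 ^ h" "sh \<le> h" "2 * h \<le> W"
  shows "push_bit sh x < (2::nat) ^ W"
proof -
  have "push_bit sh x < 2 ^ (h + sh)"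
    using assms(1) by (simp add: push_bit_eq_mult power_add)
  also have "\<dots> \<le> 2 ^ W" using assms(2,3) by (intro power_increasing) auto
  finally show ?thesis .
qed

lemma wp_outer_loop:
  assumes "mem s = memory ys" "reg s 2 = length ys" "ys = [v, length F] @ concat (map code_clause F) @ out"
    and "reg s 1 = 1" "reg s 3 = length F" "reg s 6 = n" "reg s 17 = sh" "reg s 18 = length F + 1"
    and "reg s 19 = 2 ^ h - 1" "n \<le> 2 ^ h" "sh \<le> h" "2 * h \<le> W"
    and "\<forall>C\<in>set F. \<forall>l\<in>set C. code_lit l < 2 ^ W" "16 \<le> (2::nat) ^ W"
    and "length ys + n * (length pre + length F * length es + length post) < 2 ^ W"
    and "2 ^ h * (length F + 1) + 4 < (2::nat) ^ W"
    and "\<forall>e\<in>set es. row_ok e" "\<forall>e\<in>set pre. edge_ok e" "\<forall>e\<in>set post. edge_ok e"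
    and "\<And>t s'. t \<le> n * ((10 + 3 * length es) * length (concat (map code_clause F)) +
          3 * length pre + 3 * length post + 14) + 1 \<Longrightarrow>
      mem s' = memory (ys @ concat (map (block pre es post h sh F) (rev [0..<n]))) \<Longrightarrow>
      reg s' 2 = length ys + n * (length pre + length F * length es + length post) \<Longrightarrow>
      (\<And>r. r \<notin> {2, 6, 7, 8, 9, 10, 11, 12, 13, 14, 15, 20, 21} \<Longrightarrow> reg s' r = reg s r) \<Longrightarrow> Q t s'"
  shows "wp W (outer_loop pre es post) Q s"
  using assms
proof (induction n arbitrary: s ys out Q)
  case 0
  show ?case unfolding outer_loop_def
    by (rule wp_While_False) (use "0.prems" in auto)
next
  case (Suc n)
  let ?b = "n * (length F + 1) + 4"
  let ?p = "push_bit sh n" and ?q = "push_bit sh (xor n (2 ^ h - 1))"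
  let ?m = "length pre + length F * length es + length post"
  have n: "n < 2 ^ h" using Suc.prems(10) by simp
  have pq: "?p < 2 ^ W" "?q < 2 ^ W"
    using push_bit_less[OF n Suc.prems(11,12)] push_bit_less[OF xor_mask_less[OF n] Suc.prems(11,12)] .
  have hW: "(2::nat) ^ h \<le> 2 ^ W" using Suc.prems(12) by (intro power_increasing) auto
  have x: "xor n (2 ^ h - 1) < 2 ^ W" "n < 2 ^ W"
    using xor_mask_less[OF n] n hW by linarith+
  \<comment> \<open>The last state of gadget \<open>n\<close> lies below the total number of states,
    so the state register does not overflow.\<close>
  have "(n + 1) * (length F + 1) \<le> 2 ^ h * (length F + 1)"
    using n by (intro mult_le_mono1) simp
  then have b: "?b + length F < 2 ^ W" using Suc.prems(16) by simp
  have ok: "\<forall>e\<in>set pre. src_ok e" "\<forall>e\<in>set post. src_ok e"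
    using Suc.prems(18,19) by (auto elim!: edge_ok.elims)
  have sv: "map (src_val u) es' = map (row_val (reg u 9) 0) es'" if "\<forall>e\<in>set es'. edge_ok e" for u es'
  proof -
    have "src_val u e = row_val (reg u 9) 0 e" if "edge_ok e" for e using that by (cases e) auto
    with that show ?thesis by auto
  qed
  have len: "Suc (Suc (length (concat (map code_clause F)))) \<le> length ys"
    using Suc.prems(3) by simp
  let ?ys1 = "ys @ map (row_val ?b 0) pre"
  show ?case
  proof (rule wp_While_True[where c = "outer_step pre es post" and r = 6, folded outer_loop_def])
    show "reg s 6 \<noteq> 0" using Suc.prems(6) by simp
    show "wp W (outer_step pre es post) (\<lambda>t. wp W (outer_loop pre es post) (\<lambda>u. Q (Suc (t + u)))) s"
      supply push_bit_xor[simp del]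
      unfolding outer_step_def seqs.simps
      using Suc.prems(1,2,4-9,14,15) pq x b
      apply (simp add: wp_simps)
      apply (rule wp_emits[where ys = ys])
            apply simp_all
      subgoal using ok by simp
      subgoal for t1 s1
        apply (simp add: wp_simps sv Suc.prems(18))
        apply (rule wp_clause_loop[where ys = ?ys1 and pre = "[v, length F]" and F = F
              and post = "out @ map (row_val ?b 0) pre" and p = ?p and q = ?q and b = ?b])
                        apply simp_all
        subgoal by (simp add: Suc.prems(3))
        subgoal using Suc.prems(13) by simp
        subgoal using Suc.prems(17) by simp
        subgoal for t2 s2
          apply (rule wp_emits[where ys = "?ys1 @ rows es ?p ?q ?b F"])
                apply (simp_all add: length_rows)
          subgoal using ok by simp
          subgoal for t3 s3
            apply (rule Suc.IH[where ys = "ys @ block pre es post h sh F n" and out = "out @ block pre es post h sh F n"])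
            using Suc.prems(3,10-13,16-19)
            apply (simp_all add: length_block)
            subgoal by (simp add: sv block_def Let_def)
            subgoal
              apply (rule Suc.prems(20))
                 apply (simp_all add: algebra_simps)
              done
            done
          done
        done
      done
  qed
qed

section \<open>From satisfiability to acceptance of a word\<close>

definition half_true :: "nat \<Rightarrow> nat \<Rightarrow> nat \<Rightarrow> (bool \<times> nat) list \<Rightarrow> bool" where
  "half_true h sh x C \<longleftrightarrow> clause_true (push_bit sh x) (push_bit sh (xor x (2 ^ h - 1))) C"

text \<open>Inside the window of \<open>h\<close> variables starting at \<open>sh\<close> the two
  masks are complementary. Outside it both are 0, since \<open>x < 2 ^ h\<close> has no bits from
  position \<open>h\<close> on.\<close>

lemma half_true_iff:
  assumes "x < 2 ^ h"
  shows "half_true h sh x C \<longleftrightarrow> (\<exists>(b, v)\<in>set C. sh \<le> v \<and> v - sh < h \<and> bit x (v - sh) = b)"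
proof -
  have less: "i < h" if "bit x i" for i
    using that assms by (metis bit_take_bit_iff take_bit_nat_eq_self)
  have mask: "bit (2 ^ h - Suc 0 :: nat) i \<longleftrightarrow> i < h" for i
    using bit_mask_iff[of h i, where 'a = nat] by (simp add: mask_eq_exp_minus_1)
  have eq: "bit (if b then push_bit sh x else push_bit sh (xor x (2 ^ h - 1))) v \<longleftrightarrow>
      sh \<le> v \<and> v - sh < h \<and> bit x (v - sh) = b" for b v
    by (auto simp: bit_push_bit_iff bit_xor_iff mask
        simp del: push_bit_xor dest: less)
  show ?thesis by (simp only: half_true_def clause_true_def eq)
qed

lemma ex_nat_bits: "\<exists>x<2 ^ h. \<forall>i<h. bit (x :: nat) i = f i"
proof (intro exI conjI allI impI)
  let ?x = "horner_sum of_bool 2 (map f [0..<h]) :: nat"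
  show "?x < 2 ^ h" using horner_sum_of_bool_2_less[of "map f [0..<h]"] by simp
  show "bit ?x i = f i" if "i < h" for i using that by (simp add: bit_horner_sum_bit_iff)
qed

text \<open>An assignment of \<open>2 * h\<close> variables is a pair of \<open>h\<close>-bit
  numbers. If \<open>n < 2 * h\<close>, as for odd \<open>n\<close>, the additional variables occur
  in no clause.\<close>

lemma satisfiable_iff:
  assumes "ksat_wf k (n, F)" "n \<le> 2 * h"
  shows "satisfiable (n, F) \<longleftrightarrow>
    (\<exists>x<2 ^ h. \<exists>y<2 ^ h. \<forall>C\<in>set F. half_true h 0 x C \<or> half_true h h y C)"
proof
  have var: "v < 2 * h" if "C \<in> set F" "(b, v) \<in> set C" for C b v
    using assms that by (fastforce simp: ksat_wf_def)
  {
    assume "satisfiable (n, F)"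
    then obtain f where f: "\<forall>C\<in>set F. \<exists>(b, v)\<in>set C. f v = b" by (auto simp: satisfiable_def)
    obtain x where x: "x < 2 ^ h" "\<forall>i<h. bit (x :: nat) i = f i"
      using ex_nat_bits[of h f] by blast
    obtain y where y: "y < 2 ^ h" "\<forall>i<h. bit (y :: nat) i = f (h + i)"
      using ex_nat_bits[of h "\<lambda>i. f (h + i)"] by blast
    have "half_true h 0 x C \<or> half_true h h y C" if "C \<in> set F" for C
    proof -
      obtain b v where bv: "(b, v) \<in> set C" "f v = b" using f \<open>C \<in> set F\<close> by blast
      show ?thesis
      proof (cases "v < h")
        case True
        then show ?thesis using bv x by (auto simp: half_true_iff)
      next
        case False
        then have "v - h < h" using var[OF \<open>C \<in> set F\<close> bv(1)] by simp
        then show ?thesis using False bv y by (auto simp: half_true_iff intro!: bexI[of _ "(b, v)"])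
      qed
    qed
    then show "\<exists>x<2 ^ h. \<exists>y<2 ^ h. \<forall>C\<in>set F. half_true h 0 x C \<or> half_true h h y C"
      using x(1) y(1) by blast
  }
  assume "\<exists>x<2 ^ h. \<exists>y<2 ^ h. \<forall>C\<in>set F. half_true h 0 x C \<or> half_true h h y C"
  then obtain x y where "x < 2 ^ h" "y < 2 ^ h" and
    all: "\<forall>C\<in>set F. half_true h 0 x C \<or> half_true h h y C" by blast
  define f where "f v = (if v < h then bit x v else bit y (v - h))" for v
  have "\<exists>(b, v)\<in>set C. f v = b" if "C \<in> set F" for C
  proof -
    have "half_true h 0 x C \<or> half_true h h y C" using all that by blast
    then obtain b v where "(b, v) \<in> set C" "v < h \<and> bit x v = b \<or> h \<le> v \<and> bit y (v - h) = b"
      unfolding half_true_iff[OF \<open>x < 2 ^ h\<close>] half_true_iff[OF \<open>y < 2 ^ h\<close>] by auto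
    then show ?thesis by (intro bexI[of _ "(b, v)"]) (auto simp: f_def)
  qed
  then show "satisfiable (n, F)" by (auto simp: satisfiable_def)
qed

text \<open>
  Letters: 1 clause open, 2 clause satisfied, 3 separator, 4 start marker, 5 end marker. The letter 0 never
  occurs in the word; it labels the second transition of a clause that \<open>y\<close> does not satisfy, which keeps
  all gadgets of the same shape. States: 0 start, 1 final, 2 scans before and 3 after the chosen
  row, and the gadget of \<open>y\<close> starts at \<open>y * (length F + 1) + 4\<close>.
\<close>

definition sat_word :: "nat \<Rightarrow> (bool \<times> nat) list list \<Rightarrow> nat \<Rightarrow> nat list" where
  "sat_word h F x = map (\<lambda>C. Suc (of_bool (half_true h 0 x C))) F"

definition word :: "nat \<Rightarrow> (bool \<times> nat) list list \<Rightarrow> nat list" where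
  "word h F = 4 # concat (map (\<lambda>x. 3 # sat_word h F x) (rev [0..<2 ^ h])) @ [5]"

fun gadget_path :: "nat \<Rightarrow> nat \<Rightarrow> nat \<Rightarrow> (bool \<times> nat) list list \<Rightarrow> (nat \<times> nat option \<times> nat) list" where
  "gadget_path h x q [] = [(q, None, 3)]"
| "gadget_path h x q (C # F) =
    (q, Some 2, Suc q) # (q, Some (of_bool (half_true h h x C)), Suc q) # gadget_path h x (Suc q) F"

definition gadget :: "nat \<Rightarrow> (bool \<times> nat) list list \<Rightarrow> nat \<Rightarrow> (nat \<times> nat option \<times> nat) list" where
  "gadget h F x = (2, Some 3, x * (length F + 1) + 4) # gadget_path h x (x * (length F + 1) + 4) F"

text \<open>The silent step from 0 to 3 serves strings without a start marker, the one from 2 to 1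
  strings without an end marker. A string with both has to pass from 2 to 3, which is possible only
  through a gadget.\<close>

definition base_transitions :: "(nat \<times> nat option \<times> nat) list" where
  "base_transitions = [(0, None, 3), (0, Some 4, 2),
     (2, None, 1), (2, Some 1, 2), (2, Some 2, 2), (2, Some 3, 2),
     (3, None, 1), (3, Some 1, 3), (3, Some 2, 3), (3, Some 3, 3), (3, Some 5, 3)]"

definition transitions :: "nat \<Rightarrow> (bool \<times> nat) list list \<Rightarrow> (nat \<times> nat option \<times> nat) list" where
  "transitions h F = base_transitions @ concat (map (gadget h F) (rev [0..<2 ^ h]))"

definition automaton :: "nat \<Rightarrow> (bool \<times> nat) list list \<Rightarrow> (nat, nat) enfa" where
  "automaton h F = \<lparr>states = {..<2 ^ h * (length F + 1) + 4}, alphabet = {..<6}, start = 0, final = 1,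
     trans = set (transitions h F)\<rparr>"

lemma set_gadget_path:
  "(p, l, r) \<in> set (gadget_path h x q F) \<longleftrightarrow>
    (\<exists>j<length F. p = q + j \<and> r = Suc p \<and> (l = Some 2 \<or> l = Some (of_bool (half_true h h x (F ! j))))) \<or>
    (p = q + length F \<and> l = None \<and> r = 3)"
proof (induction F arbitrary: q)
  case (Cons C F)
  show ?case
    unfolding gadget_path.simps list.set insert_iff Cons.IH Ex_less_Suc2 length_Cons by auto
qed auto

lemma in_transitions_iff:
  "(p, l, r) \<in> set (transitions h F) \<longleftrightarrow> (p, l, r) \<in> set base_transitions \<or>
    (\<exists>x<2 ^ h. let b = x * (length F + 1) + 4 in p = 2 \<and> l = Some 3 \<and> r = b \<or>
      (\<exists>j<length F. p = b + j \<and> r = Suc p \<and> (l = Some 2 \<or> l = Some (of_bool (half_true h h x (F ! j))))) \<or>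
      p = b + length F \<and> l = None \<and> r = 3)"
  by (auto simp: transitions_def gadget_def set_gadget_path Let_def)

text \<open>Each gadget occupies an interval of \<open>m + 1\<close> state numbers, so division by
  \<open>m + 1\<close> recovers its index.\<close>

lemma gadget_state_inj:
  assumes "x * (m + 1) + 4 + j = y * (m + 1) + 4 + i" "j \<le> m" "i \<le> (m::nat)"
  shows "x = y \<and> j = i"
proof -
  have "x * (m + 1) + j = y * (m + 1) + i" using assms(1) by simp
  then have "(x * (m + 1) + j) div (m + 1) = (y * (m + 1) + i) div (m + 1)" by metis
  moreover have "(z * (m + 1) + k) div (m + 1) = z" if "k \<le> m" for z k
    using that div_mult_self1[of "m + 1" k z] by (simp add: add.commute)
  ultimately have "x = y" using assms(2,3) by metis
  then show ?thesis using assms(1) by simp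
qed

section \<open>Necessary conditions for acceptance\<close>

definition matches :: "nat \<Rightarrow> (bool \<times> nat) list list \<Rightarrow> nat \<Rightarrow> nat list \<Rightarrow> bool" where
  "matches h F x u \<longleftrightarrow>
    (\<exists>v u'. u = v @ u' \<and> list_all2 (\<lambda>C a. a = 2 \<or> a = of_bool (half_true h h x C)) F v)"

lemma matches_Nil: "matches h [] x u"
  by (simp add: matches_def)

lemma matches_Cons:
  "a = 2 \<or> a = of_bool (half_true h h x C) \<Longrightarrow> matches h F x u \<Longrightarrow> matches h (C # F) x (a # u)"
  unfolding matches_def by (elim exE conjE, rule_tac x = "a # v" in exI) auto

definition scan_ok :: "nat \<Rightarrow> (bool \<times> nat) list list \<Rightarrow> nat list \<Rightarrow> bool" where
  "scan_ok h F u \<longleftrightarrow> 5 \<notin> set u \<or> (\<exists>pre x u'. x < 2 ^ h \<and> u = pre @ 3 # u' \<and> matches h F x u')"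

lemma scan_ok_Cons: "scan_ok h F u \<Longrightarrow> a \<noteq> 5 \<Longrightarrow> scan_ok h F (a # u)"
  unfolding scan_ok_def by (elim disjE exE conjE, simp, intro disjI2, rule_tac x = "a # pre" in exI) auto

text \<open>The invariant that every string leading from \<open>p\<close> to the final state
  satisfies. Inside a gadget it constrains only the part read there; what follows is left open,
  because the converse direction uses explicit paths.\<close>

definition state_ok :: "nat \<Rightarrow> (bool \<times> nat) list list \<Rightarrow> nat \<Rightarrow> nat list \<Rightarrow> bool" where
  "state_ok h F p u \<longleftrightarrow>
    (p = 0 \<longrightarrow> 4 \<notin> set u \<or> (\<exists>u'. u = 4 # u' \<and> scan_ok h F u')) \<and>
    (p = 1 \<longrightarrow> u = []) \<and> (p = 2 \<longrightarrow> scan_ok h F u) \<and> (p = 3 \<longrightarrow> 4 \<notin> set u) \<and>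
    (\<forall>x j. x < 2 ^ h \<longrightarrow> j \<le> length F \<longrightarrow> p = x * (length F + 1) + 4 + j \<longrightarrow> matches h (drop j F) x u)"

lemma state_ok_gadget:
  assumes "j \<le> length F" "matches h (drop j F) x u"
  shows "state_ok h F (x * (length F + 1) + 4 + j) u"
proof -
  have "y = x \<and> i = j"
    if "x * (length F + 1) + 4 + j = y * (length F + 1) + 4 + i" "i \<le> length F" for y i
    using gadget_state_inj[OF that(1) assms(1) that(2)] by simp
  with assms(2) show ?thesis unfolding state_ok_def by auto
qed

lemma state_ok_low:
  assumes "p < 4" and "p = 0 \<Longrightarrow> 4 \<notin> set u \<or> (\<exists>u'. u = 4 # u' \<and> scan_ok h F u')"
    "p = 1 \<Longrightarrow> u = []" "p = 2 \<Longrightarrow> scan_ok h F u" "p = 3 \<Longrightarrow> 4 \<notin> set u"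
  shows "state_ok h F p u"
  using assms unfolding state_ok_def by auto

text \<open>By induction on the path, the condition is carried backwards across the first
  transition. The end \<open>r\<close> remains a variable to suit the induction rule.\<close>

lemma state_ok_path:
  assumes "enfa_path (automaton h F) p u r" "r = 1"
  shows "state_ok h F p u"
  using assms
proof (induction rule: enfa_path.induct)
  case (1 q)
  then show ?case by (simp add: state_ok_def)
next
  case (2 p q u r)
  note ok = "2.IH"[OF "2.prems"]
  have "(p, None, q) \<in> set (transitions h F)" using 2 by (simp add: automaton_def)
  then consider "p = 0 \<and> q = 3" | "p = 2 \<and> q = 1" | "p = 3 \<and> q = 1"
    | x where "x < 2 ^ h" "p = x * (length F + 1) + 4 + length F" "q = 3"
    by (auto simp: in_transitions_iff base_transitions_def Let_def)
  then show ?case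
  proof cases
    case 4
    then show ?thesis using state_ok_gadget[of "length F" F h x u] by (simp add: matches_Nil)
  qed (use ok in \<open>auto simp: state_ok_def scan_ok_def\<close>)
next
  case (3 p a q u r)
  note ok = "3.IH"[OF "3.prems"]
  have "(p, Some a, q) \<in> set (transitions h F)" using 3 by (simp add: automaton_def)
  then consider "p = 0 \<and> a = 4 \<and> q = 2" | "p = 2 \<and> a \<in> {1, 2, 3} \<and> q = 2" | "p = 3 \<and> a \<in> {1, 2, 3, 5} \<and> q = 3"
    | x where "x < 2 ^ h" "p = 2" "a = 3" "q = x * (length F + 1) + 4"
    | x j where "x < 2 ^ h" "j < length F" "p = x * (length F + 1) + 4 + j" "q = Suc p"
       "a = 2 \<or> a = of_bool (half_true h h x (F ! j))"
    by (auto simp: in_transitions_iff base_transitions_def Let_def)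
  then show ?case
  proof cases
    case 1
    then show ?thesis using ok by (simp add: state_ok_def)
  next
    case 2
    then have "scan_ok h F u" using ok by (simp add: state_ok_def)
    then have "scan_ok h F (a # u)" using 2 by (auto intro: scan_ok_Cons)
    then show ?thesis using 2 by (intro state_ok_low) auto
  next
    case 3
    then have "4 \<notin> set u" using ok by (simp add: state_ok_def)
    then show ?thesis using 3 by (intro state_ok_low) auto
  next
    case (4 x)
    then have "matches h (drop 0 F) x u"
      using ok unfolding state_ok_def by (metis add_0_right le0)
    \<comment> \<open>The separator that enters the gadget is the split demanded by
      \<open>scan_ok\<close>, with an empty part before it.\<close>
    then have "scan_ok h F (3 # u)"
      unfolding scan_ok_def using 4(1) by (metis append_Nil drop_0)
    then show ?thesis using 4 by (intro state_ok_low) auto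
  next
    case (5 x j)
    then have "matches h (drop (Suc j) F) x u"
      using ok unfolding state_ok_def by (metis Suc_leI add_Suc_right)
    then have "matches h (drop j F) x (a # u)"
      using 5 by (simp add: Cons_nth_drop_Suc[symmetric] matches_Cons)
    then show ?thesis unfolding 5(3) using 5(2) by (intro state_ok_gadget) simp_all
  qed
qed

section \<open>Accepting paths\<close>

lemma enfa_path_append:
  "enfa_path A p u q \<Longrightarrow> enfa_path A q v r \<Longrightarrow> enfa_path A p (u @ v) r"
  by (induction rule: enfa_path.induct) (simp, metis enfa_path.intros(2), metis append_Cons enfa_path.intros(3))

lemma enfa_path_loop:
  "\<forall>a\<in>set u. (q, Some a, q) \<in> trans A \<Longrightarrow> enfa_path A q u q"
proof (induction u)
  case (Cons a u)
  then show ?case by (intro enfa_path.intros(3)[of q a q]) simp_all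
qed (rule enfa_path.intros)

lemma enfa_path_gadget:
  assumes "x < 2 ^ h" "j \<le> length F"
    and "list_all2 (\<lambda>C a. a = 2 \<or> a = of_bool (half_true h h x C)) (drop j F) v"
  shows "enfa_path (automaton h F) (x * (length F + 1) + 4 + j) v 3"
  using assms(2,3)
proof (induction v arbitrary: j)
  case Nil
  then have "j = length F" by simp
  then have "(x * (length F + 1) + 4 + j, None, 3) \<in> trans (automaton h F)"
    using assms(1) by (auto simp: automaton_def in_transitions_iff Let_def)
  then show ?case by (intro enfa_path.intros(2)[OF _ enfa_path.intros(1)])
next
  case (Cons a v)
  then have j: "j < length F" by (cases "j = length F") auto
  with Cons.prems have a: "a = 2 \<or> a = of_bool (half_true h h x (F ! j))"
    and v: "list_all2 (\<lambda>C a. a = 2 \<or> a = of_bool (half_true h h x C)) (drop (Suc j) F) v"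
    by (auto simp: Cons_nth_drop_Suc[symmetric])
  have "(x * (length F + 1) + 4 + j, Some a, x * (length F + 1) + 4 + Suc j) \<in> trans (automaton h F)"
    using assms(1) j a unfolding automaton_def enfa.simps in_transitions_iff Let_def add_Suc_right by blast
  then show ?case using Cons.IH[OF _ v] j by (intro enfa_path.intros(3)) simp_all
qed
lemma epsilon_path:
  assumes "(p, None, q) \<in> set base_transitions" "enfa_path (automaton h F) q u r"
  shows "enfa_path (automaton h F) p u r"
  using assms by (intro enfa_path.intros(2)[of p q]) (simp_all add: automaton_def transitions_def)

lemma base_path:
  assumes "(p, Some a, q) \<in> set base_transitions" "enfa_path (automaton h F) q u r"
  shows "enfa_path (automaton h F) p (a # u) r"
  using assms by (intro enfa_path.intros(3)[of p a q]) (simp_all add: automaton_def transitions_def)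

lemma base_loop:
  assumes "\<forall>a\<in>set u. (q, Some a, q) \<in> set base_transitions"
  shows "enfa_path (automaton h F) q u q"
  using assms by (intro enfa_path_loop) (simp add: automaton_def transitions_def)

lemma scan_path_end:
  assumes "set u \<subseteq> {1, 2, 3, 5}" shows "enfa_path (automaton h F) 3 u 1"
proof -
  have "enfa_path (automaton h F) 3 u 3"
    using assms by (intro base_loop) (auto simp: base_transitions_def)
  moreover have "enfa_path (automaton h F) 3 [] 1"
    by (rule epsilon_path[OF _ enfa_path.intros(1)]) (simp add: base_transitions_def)
  ultimately show ?thesis using enfa_path_append by fastforce
qed

lemma accept_no_start:
  assumes "set u \<subseteq> {1, 2, 3, 5}" shows "u \<in> enfa_lang (automaton h F)"
  using epsilon_path[OF _ scan_path_end[OF assms], of 0]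
  by (simp add: enfa_lang_def automaton_def base_transitions_def)

lemma scan_path_begin:
  assumes "set u \<subseteq> {1, 2, 3}" shows "enfa_path (automaton h F) 0 (4 # u) 2"
  by (rule base_path[OF _ base_loop]) (use assms in \<open>auto simp: base_transitions_def\<close>)

lemma accept_no_end:
  assumes "set u \<subseteq> {1, 2, 3}" shows "4 # u \<in> enfa_lang (automaton h F)"
proof -
  have "enfa_path (automaton h F) 2 [] 1"
    by (rule epsilon_path[OF _ enfa_path.intros(1)]) (simp add: base_transitions_def)
  from enfa_path_append[OF scan_path_begin[OF assms] this] show ?thesis
    by (simp add: enfa_lang_def automaton_def)
qed

lemma accept_match:
  assumes "x < 2 ^ h" "set u \<subseteq> {1, 2, 3}" "set u' \<subseteq> {1, 2, 3, 5}"
    and "list_all2 (\<lambda>C a. a = 2 \<or> a = of_bool (half_true h h x C)) F v"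
  shows "4 # u @ 3 # v @ u' \<in> enfa_lang (automaton h F)"
proof -
  have "(2, Some 3, x * (length F + 1) + 4) \<in> set (transitions h F)"
    using assms(1) unfolding in_transitions_iff Let_def by blast
  then have "(2, Some 3, x * (length F + 1) + 4 + 0) \<in> trans (automaton h F)"
    by (simp add: automaton_def)
  then have "enfa_path (automaton h F) 2 (3 # v) 3"
    using enfa_path_gadget[OF assms(1), of 0 F v] assms(4) by (intro enfa_path.intros(3)) simp_all
  from enfa_path_append[OF scan_path_begin[OF assms(2)] enfa_path_append[OF this scan_path_end[OF assms(3)]]]
  have "enfa_path (automaton h F) 0 (4 # u @ 3 # v @ u') 1" by simp
  then show ?thesis by (simp add: enfa_lang_def automaton_def)
qed

text \<open>The letter 3 occurs neither inside a \<open>sat_word\<close> nor as the end marker, so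
  each of its occurrences begins a row.\<close>

lemma block_split:
  assumes "concat (map (\<lambda>x. 3 # sat_word h F x) xs) @ [5] = u @ 3 # v"
  shows "\<exists>x\<in>set xs. \<exists>v'. v = sat_word h F x @ v'"
  using assms
proof (induction xs arbitrary: u)
  case Nil
  then show ?case by (auto simp: Cons_eq_append_conv)
next
  case (Cons x xs)
  have no3: "3 \<notin> set (sat_word h F x)" by (auto simp: sat_word_def of_bool_def split: if_splits)
  let ?rest = "concat (map (\<lambda>x. 3 # sat_word h F x) xs) @ [5]"
  show ?case
  proof (cases u)
    case Nil
    then show ?thesis using Cons.prems by auto
  next
    case (Cons a u')
    then have "sat_word h F x @ ?rest = u' @ 3 # v" using Cons.prems by simp
    then obtain us where "(sat_word h F x @ us = u' \<and> ?rest = us @ 3 # v) \<or>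
        (sat_word h F x = u' @ us \<and> us @ ?rest = 3 # v)"
      by (auto simp: append_eq_append_conv2)
    moreover have "us = []" if "sat_word h F x = u' @ us" "us @ ?rest = 3 # v"
      using that no3 by (cases us) auto
    ultimately have "\<exists>us. ?rest = us @ 3 # v" by (metis append_Nil)
    then show ?thesis using Cons.IH by auto
  qed
qed

lemma word_in_lang_iff:
  "word h F \<in> enfa_lang (automaton h F) \<longleftrightarrow>
    (\<exists>x<2 ^ h. \<exists>y<2 ^ h. \<forall>C\<in>set F. half_true h 0 x C \<or> half_true h h y C)"
proof
  \<comment> \<open>A row has letter 2 where \<open>x\<close> satisfies the clause and 1 elsewhere,
    and \<open>of_bool\<close> is 1 exactly where \<open>y\<close> satisfies it. So a position
    matches iff \<open>x\<close> or \<open>y\<close> satisfies its clause.\<close>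
  have match: "list_all2 (\<lambda>C a. a = 2 \<or> a = of_bool (half_true h h y C)) F (sat_word h F x) \<longleftrightarrow>
      (\<forall>C\<in>set F. half_true h 0 x C \<or> half_true h h y C)" for x y
    by (auto simp add: sat_word_def list_all2_map2 list_all2_same of_bool_def)
  {
    assume "word h F \<in> enfa_lang (automaton h F)"
    then have "enfa_path (automaton h F) 0 (word h F) 1" by (simp add: enfa_lang_def automaton_def)
    then have "state_ok h F 0 (word h F)" by (rule state_ok_path) (rule refl)
    then have "4 \<notin> set (word h F) \<or> (\<exists>u'. word h F = 4 # u' \<and> scan_ok h F u')"
      unfolding state_ok_def by blast
    moreover have "4 \<in> set (word h F)" by (simp add: word_def)
    ultimately obtain u where "word h F = 4 # u" "scan_ok h F u" by blast
    then have u: "u = concat (map (\<lambda>x. 3 # sat_word h F x) (rev [0..<2 ^ h])) @ [5]"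
      by (simp add: word_def)
    then have "5 \<in> set u" by simp
    with \<open>scan_ok h F u\<close> obtain pre y u' where y: "y < 2 ^ h" "matches h F y u'" and "u = pre @ 3 # u'"
      unfolding scan_ok_def by blast
    with u obtain x v where "x \<in> set (rev [0..<2 ^ h])" and x2: "u' = sat_word h F x @ v"
      using block_split[of h F "rev [0..<2 ^ h]" pre u'] by metis
    then have x: "x < 2 ^ h" by simp
    obtain v1 v2 where v: "u' = v1 @ v2"
      "list_all2 (\<lambda>C a. a = 2 \<or> a = of_bool (half_true h h y C)) F v1"
      using y(2) unfolding matches_def by blast
    \<comment> \<open>Both \<open>v1\<close> and the row have one letter per clause, so the two ways
      of splitting \<open>u'\<close> agree.\<close>
    moreover have "length v1 = length (sat_word h F x)"
      using v(2) by (simp add: sat_word_def list_all2_lengthD)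
    ultimately have "v1 = sat_word h F x" using x2 by (metis append_eq_append_conv)
    then show "\<exists>x<2 ^ h. \<exists>y<2 ^ h. \<forall>C\<in>set F. half_true h 0 x C \<or> half_true h h y C"
      using v(2) match x y(1) by blast
  }
  assume "\<exists>x<2 ^ h. \<exists>y<2 ^ h. \<forall>C\<in>set F. half_true h 0 x C \<or> half_true h h y C"
  then obtain x y where x: "x < 2 ^ h" and y: "y < 2 ^ h" and
    all: "\<forall>C\<in>set F. half_true h 0 x C \<or> half_true h h y C" by blast
  have "x \<in> set (rev [0..<2 ^ h])" using x by simp
  then obtain xs zs where split: "rev [0..<2 ^ h] = xs @ x # zs" using split_list by metis
  let ?f = "\<lambda>xs. concat (map (\<lambda>x. 3 # sat_word h F x) xs)"
  have letters: "set (?f xs) \<subseteq> {1, 2, 3}" for xs by (auto simp: sat_word_def of_bool_def split: if_splits)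
  have "4 # ?f xs @ 3 # sat_word h F x @ ?f zs @ [5] \<in> enfa_lang (automaton h F)"
    using accept_match[OF y letters[of xs] _ match[THEN iffD2, OF all], of "?f zs @ [5]"] letters[of zs] by auto
  then show "word h F \<in> enfa_lang (automaton h F)" by (simp add: word_def split)
qed

text \<open>A nonempty proper infix that starts at the left end loses the end marker; any other one
  loses the start marker. Either loss opens a silent shortcut of the automaton.\<close>

lemma sublist_word_accepted:
  assumes "sublist u (word h F)" "u \<noteq> word h F"
  shows "u \<in> enfa_lang (automaton h F)"
proof -
  define v where "v = concat (map (\<lambda>x. 3 # sat_word h F x) (rev [0..<2 ^ h]))"
  have v: "set v \<subseteq> {1, 2, 3}" by (auto simp: v_def sat_word_def of_bool_def split: if_splits)
  have w: "word h F = 4 # v @ [5]" by (simp add: word_def v_def)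
  obtain a b where ab: "4 # v @ [5] = a @ u @ b" using assms(1) w by (auto simp: sublist_def)
  show ?thesis
  proof (cases "a = [] \<and> u \<noteq> []")
    case False
    have "set u \<subseteq> {1, 2, 3, 5}"
    proof (cases a)
      case (Cons c a')
      then have "v @ [5] = a' @ u @ b" using ab by simp
      then have "set (v @ [5]) = set (a' @ u @ b)" by metis
      then show ?thesis using v by auto
    qed (use False in auto)
    then show ?thesis by (rule accept_no_start)
  next
    case True
    then obtain u' where u: "u = 4 # u'" "v @ [5] = u' @ b" using ab by (cases u) auto
    have "b \<noteq> []" using assms(2) u w by auto
    then have "v = u' @ butlast b" using u(2) by (metis butlast_append butlast_snoc)
    then show ?thesis using u(1) v accept_no_end[of u'] by auto
  qed
qed

text \<open>Prefixes are infixes and both relations are reflexive, so a single instance handles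
  both: everything but the word itself is accepted anyway.\<close>

lemma universal_matching_iff:
  assumes "R = prefix \<or> R = sublist" "ksat_wf k (n, F)" "n \<le> 2 * h"
  shows "universal_matching R (word h F, automaton h F) \<longleftrightarrow> satisfiable (n, F)"
proof -
  have "R u (word h F) \<Longrightarrow> sublist u (word h F)" for u using assms(1) by auto
  moreover have "R (word h F) (word h F)" using assms(1) by auto
  ultimately have "universal_matching R (word h F, automaton h F) \<longleftrightarrow> word h F \<in> enfa_lang (automaton h F)"
    using sublist_word_accepted by (auto simp: universal_matching_def)
  then show ?thesis using word_in_lang_iff satisfiable_iff[OF assms(2,3)] by simp
qed

section \<open>Size and encoding of the instance\<close>

lemma length_word: "length (word h F) = 2 + 2 ^ h * (length F + 1)"
  by (simp add: word_def length_concat comp_def sat_word_def sum_list_triv)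

lemma length_gadget_path: "length (gadget_path h x q F) = 2 * length F + 1"
  by (induction F arbitrary: q) auto

lemma length_transitions: "length (transitions h F) = 11 + 2 ^ h * (2 * length F + 2)"
  by (simp add: transitions_def base_transitions_def length_concat comp_def gadget_def length_gadget_path sum_list_triv)

lemma distinct_gadget_path: "distinct (gadget_path h x q F)"
  by (induction F arbitrary: q) (auto simp: set_gadget_path)

text \<open>Each transition of a gadget touches a state numbered at least 4, and the base
  transitions touch none. Distinctness is demanded by \<open>matching_enc\<close> and identifies
  \<open>m\<close> with the length of the list.\<close>

lemma distinct_transitions: "distinct (transitions h F)"
proof -
  \<comment> \<open>\<open>key\<close> recovers from a transition the gadget to which it belongs\<close>
  define key where "key = (\<lambda>(p, l :: nat option, q). ((if 4 \<le> p then p else q) - 4) div (length F + 1))"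
  have gadget: "key t = x" "4 \<le> fst t \<or> 4 \<le> snd (snd t)" if "t \<in> set (gadget h F x)" for t x
  proof -
    obtain p l q where t: "t = (p, l, q)" by (cases t)
    have d: "(x * (length F + 1) + j) div (length F + 1) = x" if "j \<le> length F" for j
      using that div_mult_self1[of "length F + 1" j x] by (simp add: add.commute)
    from that consider "p = 2" "q = x * (length F + 1) + 4"
      | j where "j \<le> length F" "p = x * (length F + 1) + 4 + j"
      unfolding t by (auto simp: gadget_def set_gadget_path)
    then have "key t = x \<and> (4 \<le> fst t \<or> 4 \<le> snd (snd t))"
    proof cases
      case 1
      then show ?thesis using d[of 0] unfolding key_def t by simp
    next
      case (2 j)
      then have "p - 4 = x * (length F + 1) + j" "4 \<le> p" by simp_all
      then show ?thesis using d[of j] 2(1) unfolding key_def t by simp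
    qed
    then show "key t = x" "4 \<le> fst t \<or> 4 \<le> snd (snd t)" by blast+
  qed
  have "distinct (gadget h F x)" for x
    by (auto simp: gadget_def distinct_gadget_path set_gadget_path)
  then have "distinct (concat (map (gadget h F) xs))" if "distinct xs" for xs
    using that gadget(1) by (induction xs) (auto, metis gadget(1))
  moreover have "distinct base_transitions" by (simp add: base_transitions_def)
  moreover have "fst t < 4 \<and> snd (snd t) < 4" if "t \<in> set base_transitions" for t
    using that by (auto simp: base_transitions_def)
  ultimately show ?thesis using gadget(2) by (fastforce simp: transitions_def)
qed

definition instance_code :: "nat \<Rightarrow> (bool \<times> nat) list list \<Rightarrow> nat list" where
  "instance_code h F = [2 ^ h * (length F + 1) + 4, 6, 0, 1, length (word h F), length (transitions h F)] @
     word h F @ concat (map code_trans (transitions h F))"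

lemma matching_enc_instance: "matching_enc (word h F, automaton h F) (instance_code h F)"
proof -
  let ?n = "2 ^ h * (length F + 1) + 4"
  have low: "x * (length F + 1) + 4 + j < ?n" if "x < 2 ^ h" "j \<le> length F" for x j
  proof -
    have "(x + 1) * (length F + 1) \<le> 2 ^ h * (length F + 1)" using that by (intro mult_le_mono1) simp
    then show ?thesis using that by simp
  qed
  have "p < ?n \<and> l \<in> insert None (Some ` {..<6}) \<and> q < ?n" if t: "(p, l, q) \<in> set (transitions h F)" for p l q
  proof -
    from t consider "(p, l, q) \<in> set base_transitions"
      | x where "x < 2 ^ h" "p = 2 \<and> l = Some 3 \<and> q = x * (length F + 1) + 4 + 0"
      | x j where "x < 2 ^ h" "j < length F" "p = x * (length F + 1) + 4 + j" "q = x * (length F + 1) + 4 + Suc j"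
          "l = Some 2 \<or> l = Some (of_bool (half_true h h x (F ! j)))"
      | x where "x < 2 ^ h" "p = x * (length F + 1) + 4 + length F" "l = None" "q = 3"
      unfolding in_transitions_iff Let_def add_0_right add_Suc_right by blast
    then show ?thesis
    proof cases
      case 1
      then show ?thesis by (auto simp: base_transitions_def)
    next
      case (2 x)
      then show ?thesis using low[of x 0] by auto
    next
      case (3 x j)
      then show ?thesis using low[of x j] low[of x "Suc j"] by (auto simp: of_bool_def split: if_splits)
    next
      case (4 x)
      then show ?thesis using low[of x "length F"] by simp
    qed
  qed
  then have wf: "enfa_wf (automaton h F)" by (fastforce simp: enfa_wf_def automaton_def)
  have "word h F \<in> lists {..<6}" by (auto simp: word_def sat_word_def of_bool_def split: if_splits)
  then show ?thesis
    using wf distinct_transitions[of h F]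
    by (auto simp: matching_enc_def instance_code_def automaton_def intro!: exI[of _ "transitions h F"])
qed

section \<open>The reduction as a program\<close>

lemma code_cnf_eq: "code_cnf (n, F) = [n, length F] @ concat (map code_clause F)"
  by (simp add: code_cnf_def code_clause_def[abs_def])

lemma init_state_eq: "init_state ys = \<lparr>reg = (\<lambda>_. 0)(0 := length ys), mem = memory ys\<rparr>"
  by (simp add: init_state_def memory_def)

lemma block_word: "block [Imm 3] [Reg 13] [] h 0 F x = 3 # sat_word h F x"
proof -
  have "rows [Reg 13] p q b F = map (\<lambda>C. Suc (of_bool (clause_true p q C))) F" for p q b
    by (induction F arbitrary: b) auto
  then show ?thesis by (simp add: block_def sat_word_def half_true_def Let_def)
qed

text \<open>The templates consist of triples whose middle cell is a label code, shifted by one: 4 is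
  the separator, 3 the letter 2, and 0 the empty word. Register 13 already holds a shifted
  label.\<close>

lemma block_gadget:
  "block [Imm 2, Imm 4, Reg 9] [Reg 9, Imm 3, Reg 21, Reg 9, Reg 13, Reg 21] [Reg 9, Imm 0, Imm 3] h h F x =
    concat (map code_trans (gadget h F x))"
proof -
  have "rows [Reg 9, Imm 3, Reg 21, Reg 9, Reg 13, Reg 21] (push_bit h x) (push_bit h (xor x (2 ^ h - 1))) b F
      @ [b + length F, 0, 3] = concat (map code_trans (gadget_path h x b F))" for b
  proof (induction F arbitrary: b)
    case (Cons C F)
    then show ?case using Cons[of "Suc b"] by (simp add: half_true_def del: push_bit_xor)
  qed simp
  then show ?thesis by (simp add: block_def gadget_def Let_def del: push_bit_xor)
qed

section \<open>Moving the output, clearing registers, and the complete program\<close>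

definition move_step :: com where
  "move_step = seqs [Op Sub 6 6 1, Op Add 11 10 0, Load 12 11, Store 10 12, Op Add 10 10 1]"

definition move_loop :: com where
  "move_loop = While 6 move_step"

text \<open>Cells beyond the output read as 0, so moving also erases the old contents.\<close>

lemma wp_move_loop:
  assumes "mem s = (\<lambda>a. if a < i then memory out a else memory (xs @ out) a)"
    and "reg s 0 = length xs" "reg s 1 = 1" "reg s 6 = k" "reg s 10 = i" "i + k = length (xs @ out)"
    and "length (xs @ out) + length xs < 2 ^ W"
    and "\<And>t s'. t \<le> 6 * k + 1 \<Longrightarrow> mem s' = memory out \<Longrightarrow>
      (\<And>r. r \<notin> {6, 10, 11, 12} \<Longrightarrow> reg s' r = reg s r) \<Longrightarrow> Q t s'"
  shows "wp W move_loop Q s"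
  using assms
proof (induction k arbitrary: s i Q)
  case 0
  then have "mem s = memory out" by (auto simp: memory_def)
  then show ?case unfolding move_loop_def
    by (intro wp_While_False) (use "0.prems" in auto)
next
  case (Suc k)
  have shift: "memory (xs @ out) (i + length xs) = memory out i" by (simp add: memory_def nth_append)
  show ?case
  proof (rule wp_While_True[where c = move_step and r = 6, folded move_loop_def])
    show "reg s 6 \<noteq> 0" using Suc.prems(4) by simp
    show "wp W move_step (\<lambda>t. wp W move_loop (\<lambda>u. Q (Suc (t + u)))) s"
      unfolding move_step_def seqs.simps
      using Suc.prems(1-7)
      apply (simp add: wp_simps shift)
      apply (rule Suc.IH[where i = "Suc i"])
             apply (simp_all add: fun_eq_iff less_Suc_eq)
      apply (rule Suc.prems(8))
        apply simp_all
      done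
  qed
qed

text \<open>Register 0 is spared, as it has to hold the input length for the given program.\<close>

fun clear_regs :: "nat \<Rightarrow> com" where
  "clear_regs 0 = Skip"
| "clear_regs (Suc k) = Seq (Const (Suc k) 0) (clear_regs k)"

lemma wp_clear_regs:
  "Q (Suc k) (s\<lparr>reg := (\<lambda>r. if 0 < r \<and> r \<le> k then 0 else reg s r)\<rparr>) \<Longrightarrow> wp W (clear_regs k) Q s"
proof (induction k arbitrary: s Q)
  case 0
  have unchanged: "(\<lambda>r. if 0 < r \<and> r \<le> 0 then 0 else reg s r) = reg s" by auto
  show ?case using 0 unfolding unchanged by (simp add: wp_simps)
next
  case (Suc k)
  let ?s = "s\<lparr>reg := (reg s)(Suc k := 0)\<rparr>"
  have eq: "?s\<lparr>reg := (\<lambda>r. if 0 < r \<and> r \<le> k then 0 else reg ?s r)\<rparr> =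
      s\<lparr>reg := (\<lambda>r. if 0 < r \<and> r \<le> Suc k then 0 else reg s r)\<rparr>"
    by (auto simp: fun_eq_iff le_Suc_eq)
  have "wp W (clear_regs k) (\<lambda>t. Q (1 + t)) ?s"
    by (rule Suc.IH) (simp only: eq, use Suc.prems in simp)
  then show ?case by (simp add: wp_simps del: fun_upd_apply)
qed

text \<open>Register 5 is still 0, so \<open>Load 5 5\<close> reads the number of variables from
  cell 0, and \<open>Load 3 1\<close> reads the number of clauses from cell 1. With
  \<open>Z = 2 ^ h * (length F + 1)\<close> in register 14, registers 9, 13 and 15 get the numbers
  of states \<open>Z + 4\<close>, of letters \<open>Z + 2\<close> and of transitions
  \<open>2 * Z + 11\<close>.\<close>

definition prelude :: com where
  "prelude = seqs [
     Const 1 1, Load 5 5, Load 3 1, Op Add 5 5 1, Op Shr 5 5 1, Op Shl 4 1 5, Op Sub 19 4 1,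
     Op Add 18 3 1, Op Mul 14 4 18, Op Or 2 0 0,
     Const 20 4, Op Add 9 14 20, Const 20 2, Op Add 13 14 20, Op Add 15 14 14, Const 20 11, Op Add 15 15 20,
     Op Or 6 4 4]"

text \<open>The first pass runs with shift 0, left in register 17 by the initial state, and writes
  the word; the second runs with shift \<open>h\<close> and writes the gadgets. The start marker 4
  closes the header emission, and the end marker 5 opens the emission between the passes. Finally
  \<open>Op Sub 0 2 0\<close> leaves the length of the output alone.\<close>

definition generate :: com where
  "generate = seqs [
     prelude, emits [Reg 9, Imm 6, Imm 0, Imm 1, Reg 13, Reg 15, Imm 4],
     outer_loop [Imm 3] [Reg 13] [],
     Op Or 17 5 5, Op Or 6 4 4, emits (map Imm (5 # concat (map code_trans base_transitions))),
     outer_loop [Imm 2, Imm 4, Reg 9] [Reg 9, Imm 3, Reg 21, Reg 9, Reg 13, Reg 21] [Reg 9, Imm 0, Imm 3],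
     Const 10 0, Op Or 6 2 2, move_loop, Op Sub 0 2 0, clear_regs 21]"

lemma length_concat_code_trans: "length (concat (map code_trans ts)) = 3 * length ts"
  by (induction ts) auto

lemma length_instance_code: "length (instance_code h F) = 41 + 7 * (2 ^ h * (length F + 1))"
  by (simp add: instance_code_def length_word length_concat_code_trans length_transitions)

lemma instance_code_eq:
  "instance_code h F =
    [2 ^ h * (length F + 1) + 4, 6, 0, 1, 2 ^ h * (length F + 1) + 2, 2 * (2 ^ h * (length F + 1)) + 11, 4] @
    concat (map (block [Imm 3] [Reg 13] [] h 0 F) (rev [0..<2 ^ h])) @
    (5 # concat (map code_trans base_transitions)) @
    concat (map (block [Imm 2, Imm 4, Reg 9] [Reg 9, Imm 3, Reg 21, Reg 9, Reg 13, Reg 21] [Reg 9, Imm 0, Imm 3] h h F)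
      (rev [0..<2 ^ h]))"
proof -
  have "concat (map code_trans (concat (map (gadget h F) xs))) =
      concat (map (\<lambda>x. concat (map code_trans (gadget h F x))) xs)" for xs
    by (induction xs) auto
  note flat = this
  have word: "block [Imm 3] [Reg 13] [] h 0 F = (\<lambda>x. 3 # sat_word h F x)"
    by (rule ext) (rule block_word)
  have gadget: "block [Imm 2, Imm 4, Reg 9] [Reg 9, Imm 3, Reg 21, Reg 9, Reg 13, Reg 21] [Reg 9, Imm 0, Imm 3] h h F =
      (\<lambda>x. concat (map code_trans (gadget h F x)))"
    by (rule ext) (rule block_gadget)
  show ?thesis
    unfolding instance_code_def length_word length_transitions word gadget
    by (simp add: word_def transitions_def flat)
qed

lemma wp_generate:
  assumes "h = (n + 1) div 2" "2 * h \<le> W" "16 \<le> (2::nat) ^ W" "n + 1 < 2 ^ W"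
    and "\<forall>C\<in>set F. \<forall>l\<in>set C. code_lit l < 2 ^ W"
    and "2 * length (code_cnf (n, F)) + length (instance_code h F) < 2 ^ W"
  shows "wp W generate (\<lambda>t s'. t \<le> 2 ^ h * (41 * length (code_cnf (n, F)) + 49) +
      6 * (length (code_cnf (n, F)) + length (instance_code h F)) + 300 \<and>
      s' = init_state (instance_code h F)) (init_state (code_cnf (n, F)))"
proof -
  define xs where "xs = code_cnf (n, F)"
  define M where "M = length F"
  define Z where "Z = 2 ^ h * (M + 1)"
  have half: "drop_bit (Suc 0) (Suc n) = h" using assms(1) by (simp add: drop_bit_Suc)
  have xs: "xs = n # M # concat (map code_clause F)" by (simp add: xs_def code_cnf_eq M_def)
  have mem01: "memory xs 0 = n" "memory xs (Suc 0) = M" by (simp_all add: xs memory_def)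
  \<comment> \<open>The formula counts twice because the move reads up to \<open>length xs\<close>
    cells beyond the end of the output.\<close>
  have cap: "2 * length xs + 41 + 7 * Z < 2 ^ W"
    using assms(6) by (simp add: length_instance_code xs_def Z_def M_def)
  have "1 * (M + 1) \<le> Z" unfolding Z_def by (rule mult_le_mono1) simp
  then have Z: "2 ^ h \<le> Z" "M < Z" "0 < Z" by (simp_all add: Z_def)
  have "(2::nat) ^ 4 \<le> 2 ^ W" using assms(3) by simp
  then have "4 \<le> W" by (simp only: power_increasing_iff)
  then have hW: "h < W" using assms(2) by linarith
  have hm: "2 ^ h - Suc 0 < (2::nat) ^ W" using Z cap by linarith
  have h2W: "h < 2 ^ W" by (rule less_trans[OF hW less_exp])
  define hdr where "hdr = [Z + 4, 6, 0, 1, Z + 2, 2 * Z + 11, 4]"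
  define mid where "mid = 5 # concat (map code_trans base_transitions)"
  let ?b1 = "block [Imm 3] [Reg 13] [] h 0 F"
  let ?b2 = "block [Imm 2, Imm 4, Reg 9] [Reg 9, Imm 3, Reg 21, Reg 9, Reg 13, Reg 21] [Reg 9, Imm 0, Imm 3] h h F"
  define out1 where "out1 = concat (map ?b1 (rev [0..<2 ^ h]))"
  define out2 where "out2 = concat (map ?b2 (rev [0..<2 ^ h]))"
  define out where "out = instance_code h F"
  have out: "out = hdr @ out1 @ mid @ out2"
    by (simp add: out_def instance_code_eq hdr_def out1_def mid_def out2_def Z_def M_def)
  have lens: "length hdr = 7" "length out1 = Z" "length mid = 34" "length out2 = 6 * Z"
    by (simp_all add: hdr_def mid_def out1_def out2_def length_concat comp_def length_block sum_list_triv
        base_transitions_def Z_def M_def algebra_simps)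
  have outlen: "length out = 41 + 7 * Z" by (simp add: out lens)
  \<comment> \<open>The left side is the output address after both passes.\<close>
  have total: "6 * 2 ^ h + (length xs + (41 + (Z + 2 ^ h * (M + (M + (M + (M + (M + M)))))))) = length xs + length out"
    by (simp add: outlen Z_def algebra_simps)
  have total_bound: "length xs + length out < 2 ^ W" "length xs + length out + length xs < 2 ^ W"
    using cap by (simp_all add: outlen)
  have mid16: "\<forall>k\<in>set mid. k < 16" by (simp add: mid_def base_transitions_def)
  define T where "T = 2 ^ h * (41 * length xs + 49) + 6 * (length xs + length out) + 300"
  define C where "C = length (concat (map code_clause F))"
  have C: "C \<le> length xs" by (simp add: C_def xs)
  have "2 ^ h * C \<le> 2 ^ h * length xs" using C by simp
  \<comment> \<open>The coefficients 13 and 28 are \<open>10 + 3 * length es\<close> for rows of 1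
    and 6 cells, and 17 and 32 pay for the surrounding templates. The 300 covers the prelude, the
    constant emissions and the clean-up.\<close>
  then have T: "2 ^ h * (13 * C + 17) + 2 ^ h * (28 * C + 32) + 6 * (length xs + length out) + 300 \<le> T"
    by (simp add: T_def algebra_simps)
  have lits: "\<forall>C\<in>set F. \<forall>l\<in>set C. code_lit l < 2 ^ W" by (rule assms(5))
  have Zeq: "2 ^ h + 2 ^ h * M = Z" "2 * 2 ^ h + (2 * (M * 2 ^ h) + 11) = 2 * Z + 11"
    "2 ^ h + M * 2 ^ h = Z" by (simp_all add: Z_def)
  have xs_eq: "xs = [n, length F] @ concat (map code_clause F) @ []" by (simp add: xs M_def)
  have emitted: "map (src_val u) (map Imm zs) = zs" for u zs by (induction zs) auto
  have "wp W generate (\<lambda>t s'. t \<le> T \<and> s' = \<lparr>reg = (\<lambda>_. 0)(0 := length out), mem = memory out\<rparr>)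
      \<lparr>reg = (\<lambda>_. 0)(0 := length xs), mem = memory xs\<rparr>"
    unfolding generate_def prelude_def seqs.simps mid_def[symmetric]
    using cap Z hW h2W assms(4) hm
    apply (simp add: wp_simps mem01 half push_bit_eq_mult Zeq del: emits.simps)
    apply (rule wp_emits[where ys = xs])
          apply (simp_all add: assms(3))
    subgoal for t1 s1
      apply (subst wp_Seq)
      apply (rule wp_outer_loop[where ys = "xs @ hdr" and v = n and F = F and out = hdr and n = "2 ^ h"
              and sh = 0 and h = h])
      subgoal by (simp add: hdr_def)
      subgoal by (simp add: hdr_def)
      subgoal by (simp add: xs M_def)
      subgoal by simp
      subgoal by (simp add: M_def)
      subgoal by simp
      subgoal by simp
      subgoal by (simp add: M_def)
      subgoal by simp
      subgoal by simp
      subgoal by simp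
      subgoal by (rule assms(2))
      subgoal by (rule lits)
      subgoal by (rule assms(3))
      subgoal by (simp add: lens M_def[symmetric] Zeq)
      subgoal by (simp add: M_def[symmetric] Zeq)
      subgoal by simp
      subgoal by simp
      subgoal by simp
      subgoal for t2 s2
        apply (simp add: lens out1_def[symmetric] C_def[symmetric] M_def[symmetric] Zeq wp_Seq wp_Op)
        apply (rule wp_emits[where ys = "xs @ hdr @ out1"])
        subgoal by simp
        subgoal by (simp add: lens)
        subgoal by simp
        subgoal by (simp add: lens)
        subgoal by (rule assms(3))
        subgoal using mid16 by simp
        subgoal for t3 s3
          apply (simp add: emitted lens wp_Seq del: map_map)
          apply (rule wp_outer_loop[where ys = "xs @ hdr @ out1 @ mid" and v = n and F = F
                and out = "hdr @ out1 @ mid" and n = "2 ^ h" and sh = h and h = h])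
          subgoal by simp
          subgoal by (simp add: lens)
          subgoal by (simp add: xs M_def)
          subgoal by simp
          subgoal by (simp add: M_def)
          subgoal by simp
          subgoal by simp
          subgoal by (simp add: M_def)
          subgoal by simp
          subgoal by simp
          subgoal by simp
          subgoal by (rule assms(2))
          subgoal by (rule lits)
          subgoal by (rule assms(3))
          subgoal using cap by (simp add: lens M_def[symmetric] Z_def algebra_simps)
          subgoal by (simp add: M_def[symmetric] Zeq)
          subgoal by simp
          subgoal by simp
          subgoal by simp
          subgoal for t4 s4
            apply (simp add: lens out2_def[symmetric] out[symmetric] C_def[symmetric] M_def[symmetric] Zeq
                total total_bound wp_Seq wp_Op wp_Const)
            apply (rule wp_move_loop[where xs = xs and out = out and i = 0 and k = "length (xs @ out)"])
            subgoal by simp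
            subgoal by simp
            subgoal by simp
            subgoal by simp
            subgoal by simp
            subgoal by simp
            subgoal using total_bound by simp
            subgoal for t5 s5
              apply (simp add: wp_Seq wp_Op)
              using total_bound
              apply (simp add: wp_simps)
              apply (rule wp_clear_regs)
              apply (intro conjI)
              subgoal using T by (simp add: algebra_simps)
              subgoal by (rule state.equality) (auto simp: fun_eq_iff)
              done
            done
          done
        done
      done
    done
  then show ?thesis by (simp add: T_def out_def xs_def init_state_eq)
qed

section \<open>Time and word size\<close>

lemma sum_list_le_length_times: "\<forall>x\<in>set xs. x \<le> b \<Longrightarrow> sum_list xs \<le> length xs * (b :: nat)"
  by (induction xs) auto

text \<open>Entries are state numbers, letter codes or sizes, all dominated by the length
  \<open>41 + 7 * Z\<close> with \<open>Z = 2 ^ h * (length F + 1)\<close>. Thus the sum of the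
  entries, which enters the word size, is at most quadratic in the length.\<close>

lemma instance_code_le_length:
  assumes "a \<in> set (instance_code h F)" shows "a \<le> length (instance_code h F)"
proof -
  let ?n = "2 ^ h * (length F + 1) + 4"
  have wf: "enfa_wf (automaton h F)" and word: "word h F \<in> lists {..<6}"
    using matching_enc_instance[of h F] by (simp_all add: matching_enc_def automaton_def)
  have trans: "p < ?n \<and> q < ?n \<and> (\<forall>b. l = Some b \<longrightarrow> b < 6)" if "(p, l, q) \<in> set (transitions h F)" for p l q
    using wf that by (fastforce simp: enfa_wf_def automaton_def)
  have "a \<le> ?n + 6" if "a \<in> set (concat (map code_trans (transitions h F)))"
  proof -
    obtain p l q where "(p, l, q) \<in> set (transitions h F)" "a \<in> set (code_trans (p, l, q))"
      using \<open>a \<in> set (concat (map code_trans (transitions h F)))\<close> by auto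
    then show ?thesis using trans[of p l q] by (cases l) auto
  qed
  moreover have "a \<le> 6" if "a \<in> set (word h F)" using word that by fastforce
  moreover have "a \<le> length (instance_code h F)"
    if "a \<in> set [2 ^ h * (length F + 1) + 4, 6, 0, 1, length (word h F), length (transitions h F)]"
    using that by (auto simp: length_instance_code length_word length_transitions)
  moreover have "a \<in> set [2 ^ h * (length F + 1) + 4, 6, 0, 1, length (word h F), length (transitions h F)] \<or>
      a \<in> set (word h F) \<or> a \<in> set (concat (map code_trans (transitions h F)))"
    using assms unfolding instance_code_def set_append Un_iff .
  moreover have "?n + 6 \<le> length (instance_code h F)" by (simp add: length_instance_code)
  ultimately show ?thesis by linarith
qed

lemma powr_le_self: "1 \<le> (x::real) \<Longrightarrow> e \<le> 1 \<Longrightarrow> x powr e \<le> x"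
  using powr_mono[of e 1 x] by simp

context
  fixes n h :: nat and F :: "(bool \<times> nat) list list" and \<delta> :: real
  assumes h: "h = (n + 1) div 2" and \<delta>: "\<delta> \<le> 1 / 2" "0 < \<delta>"
begin

definition len :: real where "len = real (length (code_cnf (n, F)))"

definition sat_time :: real where "sat_time = 2 powr ((1 - \<delta>) * real n) * len ^ 2"

lemma len_ge: "real (length F) + 2 \<le> len"
proof -
  have "length F \<le> length (concat (map code_clause F))"
    by (induction F) (auto simp: code_clause_def)
  then show ?thesis by (simp add: len_def code_cnf_eq)
qed

lemma size_le: "2 ^ h * (real (length F) + 1) \<le> 2 ^ h * len"
  using len_ge by (intro mult_left_mono) auto

lemma one_le_size: "1 \<le> 2 ^ h * len"
  using mult_mono[of 1 "2 ^ h" 1 len] len_ge by simp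

text \<open>The instance has size about \<open>2 ^ (n / 2)\<close>, which the target bound covers
  because \<delta> \<le> 1 / 2. The factor 2 pays for rounding \<open>h\<close> up.\<close>

lemma size_le_time: "2 ^ h * len \<le> 2 * sat_time"
proof -
  have "real h \<le> 1 + real n / 2" using h by linarith
  also have "\<dots> \<le> 1 + (1 - \<delta>) * real n"
    using mult_right_mono[of "1 / 2" "1 - \<delta>" "real n"] \<delta> by simp
  finally have "2 powr real h \<le> 2 powr (1 + (1 - \<delta>) * real n)" by simp
  then have A: "2 ^ h \<le> 2 * 2 powr ((1 - \<delta>) * real n)" by (simp add: powr_realpow powr_add)
  have "len \<le> len ^ 2" using len_ge by (simp add: power2_eq_square)
  then have "2 ^ h * len \<le> 2 * 2 powr ((1 - \<delta>) * real n) * len ^ 2"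
    using A len_ge by (intro mult_mono) auto
  then show ?thesis by (simp add: sat_time_def)
qed

lemma matching_time_le:
  assumes "\<delta> \<le> \<epsilon>"
  shows "matching_time \<epsilon> (word h F, automaton h F) \<le> 112 * sat_time"
proof -
  let ?S = "2 ^ h * len"
  define w where "w = real (length (word h F))"
  define m where "m = real (card (trans (automaton h F)))"
  have m: "m = real (length (transitions h F))"
    by (simp add: m_def automaton_def distinct_card distinct_transitions)
  have w_le: "2 \<le> w" "w \<le> 3 * ?S"
    using one_le_size size_le by (simp_all add: w_def length_word algebra_simps)
  have m_le: "11 \<le> m" "m \<le> 13 * ?S"
    using one_le_size size_le by (simp_all add: m length_transitions algebra_simps)
  have N2: "(2 ^ h)\<^sup>2 \<le> 2 * 2 powr real n"
  proof -
    have "(2::real) ^ (2 * h) \<le> 2 ^ (n + 1)" using h by (intro power_increasing) auto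
    then show ?thesis by (simp add: powr_realpow power_mult[symmetric] mult.commute)
  qed
  have "w * m \<le> (3 * ?S) * (13 * ?S)" using w_le m_le one_le_size by (intro mult_mono) auto
  also have "\<dots> = 39 * ((2 ^ h)\<^sup>2 * len ^ 2)" by (simp add: power2_eq_square)
  also have "\<dots> \<le> 39 * ((2 * 2 powr real n) * len ^ 2)"
    using N2 by (intro mult_left_mono mult_right_mono) auto
  finally have wm: "w * m \<le> 78 * 2 powr real n * len ^ 2" by simp
  \<comment> \<open>A base of at least 1 allows the exponent to grow from
    \<open>1 - \<epsilon>\<close> to \<open>1 - \<delta>\<close>, also when it was negative.\<close>
  have "1 \<le> w * m" using mult_mono[of 1 w 1 m] w_le m_le by simp
  then have "(w * m) powr (1 - \<epsilon>) \<le> (w * m) powr (1 - \<delta>)"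
    using assms by (intro powr_mono) auto
  also have "\<dots> \<le> (78 * 2 powr real n * len ^ 2) powr (1 - \<delta>)"
    using wm \<open>1 \<le> w * m\<close> \<delta> by (intro powr_mono2) auto
  also have "\<dots> = 78 powr (1 - \<delta>) * 2 powr ((1 - \<delta>) * real n) * (len ^ 2) powr (1 - \<delta>)"
    by (simp add: powr_mult powr_powr mult.commute)
  also have "\<dots> \<le> 78 * 2 powr ((1 - \<delta>) * real n) * len ^ 2"
    using \<delta> len_ge by (intro mult_mono powr_le_self) (auto simp: one_le_power)
  finally have "(w * m) powr (1 - \<epsilon>) \<le> 78 * sat_time" by (simp add: sat_time_def)
  moreover have "1 + w + m \<le> 34 * sat_time"
    using w_le m_le one_le_size size_le_time by linarith
  ultimately show ?thesis
    by (simp add: matching_time_def w_def[symmetric] m_def[symmetric])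
qed

lemma length_instance_le: "real (length (instance_code h F)) \<le> 96 * sat_time"
  using one_le_size size_le size_le_time by (simp add: length_instance_code algebra_simps)

lemma generate_time_le:
  "2 ^ h * (41 * len + 49) + 6 * (len + real (length (instance_code h F))) + 300 \<le> 1368 * sat_time"
proof -
  have "2 ^ h \<le> 2 ^ h * len" "len \<le> 2 ^ h * len"
    using len_ge mult_left_mono[of 1 len "2 ^ h"] mult_right_mono[of 1 "2 ^ h" len] by auto
  moreover have "real (length (instance_code h F)) \<le> 48 * (2 ^ h * len)"
    using one_le_size size_le by (simp add: length_instance_code algebra_simps)
  ultimately have "41 * (2 ^ h * len) + 49 * 2 ^ h + 6 * len + 6 * real (length (instance_code h F)) + 300
      \<le> 1368 * sat_time"
    using one_le_size size_le_time by linarith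
  then show ?thesis by (simp add: algebra_simps)
qed

text \<open>The argument of the logarithm in the word-size bound for the formula.\<close>

definition sat_size :: real where
  "sat_size = 2 + len + real (sum_list (code_cnf (n, F))) + sat_time"

lemma sat_size_ge:
  "2 \<le> sat_size" "len < sat_size" "sat_time \<le> sat_size" "0 \<le> sat_time"
  "a \<in> set (code_cnf (n, F)) \<Longrightarrow> real a + 1 < sat_size"
proof -
  have T: "0 \<le> sat_time" by (simp add: sat_time_def)
  then show "0 \<le> sat_time" .
  show "2 \<le> sat_size" "len < sat_size" "sat_time \<le> sat_size"
    using T len_ge by (simp_all add: sat_size_def)
  assume "a \<in> set (code_cnf (n, F))"
  then have "real a \<le> real (sum_list (code_cnf (n, F)))" by (simp add: member_le_sum_list)
  then show "real a + 1 < sat_size" using T len_ge by (simp add: sat_size_def)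
qed

text \<open>A polynomial bound suffices, as the logarithm turns the exponent 16 into a constant
  factor. Since \<open>sat_size\<close> is at least 2, its 14th power absorbs the constant
  \<open>2 ^ 14\<close>.\<close>

lemma instance_size_le:
  assumes "\<delta> \<le> \<epsilon>"
  shows "2 + real (length (instance_code h F)) + real (sum_list (instance_code h F)) +
    matching_time \<epsilon> (word h F, automaton h F) \<le> sat_size ^ 16"
proof -
  let ?l = "real (length (instance_code h F))"
  have l: "?l \<le> 96 * sat_size" using length_instance_le sat_size_ge by linarith
  have "sum_list (instance_code h F) \<le> length (instance_code h F) * length (instance_code h F)"
    using instance_code_le_length by (intro sum_list_le_length_times) blast
  then have "real (sum_list (instance_code h F)) \<le> ?l * ?l" by (metis of_nat_le_iff of_nat_mult)
  also have "\<dots> \<le> (96 * sat_size) * (96 * sat_size)" using l by (intro mult_mono) auto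
  finally have s: "real (sum_list (instance_code h F)) \<le> 9216 * sat_size ^ 2"
    by (simp add: power2_eq_square)
  have t: "matching_time \<epsilon> (word h F, automaton h F) \<le> 112 * sat_size"
    using matching_time_le[OF assms] sat_size_ge by linarith
  have sq: "2 * sat_size \<le> sat_size ^ 2" using sat_size_ge(1) by (simp add: power2_eq_square)
  have "2 + ?l + real (sum_list (instance_code h F)) + matching_time \<epsilon> (word h F, automaton h F)
      \<le> 2 ^ 14 * sat_size ^ 2"
    using l s t sq sat_size_ge(1) by simp
  also have "\<dots> \<le> sat_size ^ 14 * sat_size ^ 2"
    using sat_size_ge(1) by (intro mult_right_mono power_mono) auto
  finally show ?thesis by (simp add: power_add[symmetric])
qed

lemma word_size:
  fixes W :: nat
  assumes W: "8 * log 2 sat_size \<le> real W"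
  shows "16 \<le> (2::nat) ^ W" "2 * h \<le> W" "2 * length (code_cnf (n, F)) + length (instance_code h F) < 2 ^ W"
    "a \<in> set (code_cnf (n, F)) \<Longrightarrow> a + 1 < 2 ^ W" "length (code_cnf (n, F)) < 2 ^ W"
proof -
  note S = sat_size_ge(1)
  have "sat_size ^ 8 = 2 powr (8 * log 2 sat_size)"
    using S by (simp add: powr_mult_base log_powr_cancel powr_powr[symmetric] mult.commute[of 8] powr_numeral)
  also have "\<dots> \<le> 2 powr real W" using W by simp
  finally have pow: "sat_size ^ 8 \<le> 2 ^ W" by (simp add: powr_realpow)
  have less: "k < 2 ^ W" if "real k < sat_size ^ 8" for k
    using that pow by (metis le_less_trans less_le_trans numeral_power_less_of_nat_cancel_iff of_nat_less_numeral_power_cancel_iff)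
  \<comment> \<open>Seven of the eight factors absorb constants up to 128, enough for the 98 needed
    for the formula twice plus the instance.\<close>
  have S7: "128 * sat_size \<le> sat_size ^ 8"
    using mult_right_mono[OF power_mono[OF S, of 7], of sat_size] S by (simp add: power_Suc2[symmetric])
  have "real 16 < sat_size ^ 8" using S7 S by simp
  then show "16 \<le> (2::nat) ^ W" using less[of 16] by simp
  have "real (2 * length (code_cnf (n, F)) + length (instance_code h F)) < sat_size ^ 8"
    using length_instance_le sat_size_ge S7 by (simp add: len_def)
  then show "2 * length (code_cnf (n, F)) + length (instance_code h F) < 2 ^ W" by (rule less)
  then show "length (code_cnf (n, F)) < 2 ^ W" by simp
  show "a + 1 < 2 ^ W" if "a \<in> set (code_cnf (n, F))"
    using sat_size_ge(5)[OF that] S7 S by (intro less) simp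
  have "(2::real) ^ h \<le> 2 ^ h * len" using len_ge mult_left_mono[of 1 len "2 ^ h"] by simp
  also have "\<dots> \<le> 2 * sat_size" using size_le_time sat_size_ge(3) by simp
  also have "\<dots> \<le> sat_size ^ 2" using S by (simp add: power2_eq_square)
  finally have "((2::real) ^ h) ^ 2 \<le> (sat_size ^ 2) ^ 2" by (intro power_mono) auto
  also have "\<dots> = sat_size ^ 4" by (simp add: power_mult[symmetric])
  also have "\<dots> \<le> sat_size ^ 8" using S by (intro power_increasing) auto
  also have "\<dots> \<le> 2 ^ W" by (rule pow)
  finally have "(2::real) ^ (2 * h) \<le> 2 ^ W" by (simp add: power_mult[symmetric] mult.commute)
  then show "2 * h \<le> W" by simp
qed

end

section \<open>From fast matching to fast k-SAT\<close>

lemma ksat_reduction: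
  fixes R :: "nat list \<Rightarrow> nat list \<Rightarrow> bool"
  assumes R: "R = prefix \<or> R = sublist" and "\<epsilon> > 0"
    and "solvable_in_time matching_enc (universal_matching R) (matching_time \<epsilon>)"
  shows "solvable_in_time (ksat_enc k) satisfiable
    (\<lambda>\<phi>. 2 powr ((1 - min \<epsilon> (1 / 2)) * real (fst \<phi>)) * real (length (code_cnf \<phi>)) ^ 2)"
proof -
  define \<delta> where "\<delta> = min \<epsilon> (1 / 2)"
  have \<delta>: "\<delta> \<le> 1 / 2" "0 < \<delta>" "\<delta> \<le> \<epsilon>" using assms(2) by (auto simp: \<delta>_def)
  obtain P c where P: "\<And>i xs. matching_enc i xs \<Longrightarrow> \<exists>W t s'.
      real W \<le> c * log 2 (2 + real (length xs) + real (sum_list xs) + matching_time \<epsilon> i) \<and>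
      (\<forall>x\<in>set (length xs # xs). x < 2 ^ W) \<and> exec W P (init_state xs) t s' \<and>
      real t \<le> c * matching_time \<epsilon> i \<and> (reg s' 0 \<noteq> 0 \<longleftrightarrow> universal_matching R i)"
    using assms(3) unfolding solvable_in_time_def by blast
  \<comment> \<open>1368 and 112 come from \<open>generate_time_le\<close> and
    \<open>matching_time_le\<close>; the absolute value covers a negative \<open>c\<close>. The same
    constant exceeds the word-size factor \<open>9 + 16 * \<bar>c\<bar>\<close>.\<close>
  define c' where "c' = 1368 + 112 * \<bar>c\<bar>"
  show ?thesis
    unfolding solvable_in_time_def \<delta>_def[symmetric]
  proof (intro exI[of _ "Seq generate P"] exI[of _ c'] allI impI)
    fix \<phi> xs
    assume enc: "ksat_enc k \<phi> xs"
    obtain n F where \<phi>: "\<phi> = (n, F)" by (cases \<phi>)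
    have wf: "ksat_wf k (n, F)" and xs: "xs = code_cnf (n, F)" using enc by (auto simp: ksat_enc_def \<phi>)
    define h where "h = (n + 1) div 2"
    define S where "S = sat_size n F \<delta>"
    define T where "T = sat_time n F \<delta>"
    let ?i = "(word h F, automaton h F)" and ?out = "instance_code h F"
    note facts = h_def \<delta>(1,2)
    have S2: "2 \<le> S" unfolding S_def by (rule sat_size_ge(1)[OF facts])
    then have logS: "1 \<le> log 2 S" by simp
    have T0: "0 \<le> T" unfolding T_def by (rule sat_size_ge(4)[OF facts])
    have mt0: "0 \<le> matching_time \<epsilon> ?i" by (simp add: matching_time_def)
    obtain WP tP s' where WP: "real WP \<le> c * log 2 (2 + real (length ?out) + real (sum_list ?out) + matching_time \<epsilon> ?i)"
      and run: "exec WP P (init_state ?out) tP s'" and tP: "real tP \<le> c * matching_time \<epsilon> ?i"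
      and yes: "reg s' 0 \<noteq> 0 \<longleftrightarrow> universal_matching R ?i"
      using P[OF matching_enc_instance[of h F]] by blast
    have "log 2 (2 + real (length ?out) + real (sum_list ?out) + matching_time \<epsilon> ?i) \<le> log 2 (S ^ 16)"
      unfolding S_def using instance_size_le[OF facts \<delta>(3)] mt0 by (intro log_mono) auto
    also have "\<dots> = 16 * log 2 S" using S2 by (simp add: log_nat_power)
    finally have "real WP \<le> \<bar>c\<bar> * (16 * log 2 S)"
      using WP mt0 by (intro order_trans[OF WP] mult_mono) auto
    moreover define W0 where "W0 = nat \<lceil>8 * log 2 S\<rceil>"
    moreover have W0: "8 * log 2 S \<le> real W0" "real W0 \<le> 9 * log 2 S"
      unfolding W0_def using logS by linarith+
    \<comment> \<open>The sum is large enough for the reduction, which needs \<open>W0\<close>, and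
      for the given program, which needs \<open>WP\<close>.\<close>
    moreover define W where "W = W0 + WP"
    moreover have "16 * \<bar>c\<bar> * log 2 S \<le> 112 * \<bar>c\<bar> * log 2 S"
      using logS by (intro mult_right_mono) auto
    ultimately have W_le: "real W \<le> c' * log 2 S"
      using logS by (simp add: c'_def algebra_simps)
    have W: "8 * log 2 (sat_size n F \<delta>) \<le> real W" using W0(1) by (simp add: W_def S_def)
    note size = word_size[OF facts W]
    have "code_lit l < 2 ^ W" if "C \<in> set F" "l \<in> set C" for C l
    proof -
      have "code_lit l \<in> set (code_cnf (n, F))" using that by (force simp: code_cnf_def)
      then show ?thesis using size(4)[of "code_lit l"] by simp
    qed
    moreover have "n + 1 < 2 ^ W" by (rule size(4)) (simp add: code_cnf_def)
    ultimately obtain tg where tg: "exec W generate (init_state xs) tg (init_state ?out)"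
      and tg_le: "tg \<le> 2 ^ h * (41 * length (code_cnf (n, F)) + 49) +
        6 * (length (code_cnf (n, F)) + length ?out) + 300"
      using wp_generate[OF h_def size(2,1) _ _ size(3)] unfolding wp_def xs by blast
    have "exec W P (init_state ?out) tP s'" by (rule exec_word_mono[OF run]) (simp add: W_def)
    with tg have exec: "exec W (Seq generate P) (init_state xs) (tg + tP) s'" by (rule exec.Seq)
    have "real tg \<le> 1368 * T"
      unfolding T_def using generate_time_le[OF facts, of F]
      by (intro order_trans[OF of_nat_mono[OF tg_le]]) (simp add: len_def[OF facts])
    moreover have "real tP \<le> \<bar>c\<bar> * (112 * T)"
      using matching_time_le[OF facts \<delta>(3), of F] mt0
      by (intro order_trans[OF tP] mult_mono) (auto simp: T_def)
    ultimately have time: "real (tg + tP) \<le> c' * T" by (simp add: c'_def algebra_simps)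
    have yes': "reg s' 0 \<noteq> 0 \<longleftrightarrow> satisfiable \<phi>"
      using yes universal_matching_iff[OF R wf, of h] by (simp add: \<phi> h_def)
    have T_eq: "T = 2 powr ((1 - \<delta>) * real (fst \<phi>)) * real (length (code_cnf \<phi>)) ^ 2"
      by (simp add: T_def sat_time_def[OF facts] len_def[OF facts] \<phi>)
    have S_eq: "S = 2 + real (length xs) + real (sum_list xs) + T"
      by (simp add: S_def T_def sat_size_def[OF facts] len_def[OF facts] xs)
    have "\<forall>x\<in>set (length xs # xs). x < 2 ^ W"
      using size(4,5) by (auto simp: xs dest: Suc_lessD)
    then show "\<exists>W t s'. real W \<le> c' * log 2 (2 + real (length xs) + real (sum_list xs) +
          2 powr ((1 - \<delta>) * real (fst \<phi>)) * real (length (code_cnf \<phi>)) ^ 2) \<and>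
        (\<forall>x\<in>set (length xs # xs). x < 2 ^ W) \<and> exec W (Seq generate P) (init_state xs) t s' \<and>
        real t \<le> c' * (2 powr ((1 - \<delta>) * real (fst \<phi>)) * real (length (code_cnf \<phi>)) ^ 2) \<and>
        (reg s' 0 \<noteq> 0 \<longleftrightarrow> satisfiable \<phi>)"
      using W_le exec time yes' unfolding S_eq T_eq by blast
  qed
qed

theorem theorem7p2:
  fixes R :: "nat list \<Rightarrow> nat list \<Rightarrow> bool"
  assumes "R = prefix \<or> R = sublist"
    and "\<exists>\<epsilon>>0. solvable_in_time matching_enc (universal_matching R) (matching_time \<epsilon>)"
  shows "\<not> SETH"
proof
  assume SETH
  obtain \<epsilon> where \<epsilon>: "\<epsilon> > 0" "solvable_in_time matching_enc (universal_matching R) (matching_time \<epsilon>)"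
    using assms(2) by blast
  then have "min \<epsilon> (1 / 2) > 0" by simp
  with \<open>SETH\<close> obtain k where "\<And>d :: nat. \<not> solvable_in_time (ksat_enc k) satisfiable
      (\<lambda>\<phi>. 2 powr ((1 - min \<epsilon> (1 / 2)) * real (fst \<phi>)) * real (length (code_cnf \<phi>)) ^ d)"
    unfolding SETH_def by blast
  \<comment> \<open>The reduction works for every \<open>k\<close>; its exponent
    \<open>d = 2\<close> contradicts the choice of \<open>k\<close>.\<close>
  with ksat_reduction[OF assms(1) \<epsilon>] show False by blast
qed

end
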